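(* Let $k\colon R\to\mathbb{C}$ be a $W$-invariant multiplicity function with $\operatorname{Re} k_\alpha\ge 0$ for all $\alpha\in R$, let $\lambda=\lambda_1+i\lambda_2$ with $\lambda_1\in\mathfrak{a}$ and $\lambda_2\in\mathfrak{a}_{\mathrm{reg}}$, and let $p\in\mathbb{C}[\mathfrak{a}]$. Then there exists a constant $C=C_{R,k,\lambda,p}\ge 0$ such that $$|p(\partial)\operatorname{Exp}_k(\lambda,x)|\le C\,e^{\max_{w\in W}\operatorname{Re}\langle w\lambda,x\rangle}\,\big|\Omega_k^{-1/2}(x)\big|\qquad\text{for all } x\in\mathfrak{a},$$ where $p(\partial)$ acts in the $x$-variable.
   Context: $(\mathfrak{a},\langle\cdot,\cdot\rangle)$ is a finite-dimensional Euclidean space; $\langle\cdot,\cdot\rangle$ is extended to a complex bilinear form on $\mathfrak{a}_{\mathbb{C}}=\mathbb{C}\otimes_{\mathbb{R}}\mathfrak{a}$. $R\subseteq\mathfrak{a}$ is a reduced root system spanning $\mathfrak{a}$ (a finite set of nonzero vectors, stable under all its reflections, with $R\cap\mathbb{R}\alpha=\{\pm\alpha\}$; the crystallographic condition is not imposed), normalized by $\langle\alpha,\alpha\rangle=2$ for all $\alpha\in R$. $W$ is the finite reflection group generated by $s_\alpha(x)=x-\langle\alpha,x\rangle\alpha$, $\alpha\in R$ (acting complex linearly on $\mathfrak{a}_{\mathbb{C}}$). $R_+\subseteq R$ is a fixed set of positive roots. $\mathfrak{a}_{\mathrm{reg}}=\{x\in\mathfrak{a}:\langle\alpha,x\rangle\ne0\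 \forall\alpha\in R\}$. $\mathbb{C}[\mathfrak{a}]$ is the algebra of complex polynomial functions on $\mathfrak{a}$; identifying $\mathfrak{a}\cong\mathfrak{a}^*$ via $\langle\cdot,\cdot\rangle$, the map $\xi\mapsto\partial_\xi$ (directional derivative) extends to an algebra homomorphism $p\mapsto p(\partial)$ onto the constant coefficient differential operators. For a $W$-invariant $k\colon R\to\mathbb{C}$, the Dunkl operator in direction $\xi\in\mathfrak{a}$ is $T_\xi=\partial_\xi+\sum_{\alpha\in R_+}k_\alpha\langle\alpha,\xi\rangle\frac{1-s_\alpha}{\langle\alpha,\cdot\rangle}$, where $(s_\alpha f)(x)=f(s_\alpha x)$. If $\operatorname{Re}k\ge0$, the Dunkl kernel $\operatorname{Exp}_k\colon\mathfrak{a}_{\mathbb{C}}\times\mathfrak{a}_{\mathbb{C}}\to\mathbb{C}$ is the unique holomorphic function such that for every $\lambda\in\mathfrak{a}_{\mathbb{C}}$, $f=\operatorname{Exp}_k(\lambda,\cdot)$ is the unique solution of $T_\xi f=\langle\xi,\lambda\rangle f$ for all $\xi\in\mathfrak{a}$, $f(0)=1$. $\Omega_k^{-1/2}(x)=\prod_{\alpha\in R_+}(1+|\langle\alpha,x\rangle|)^{-k_\alpha}$ for $x\in\mathfrak{a}$. *)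

theory Defs
  imports "HOL-Analysis.Analysis"
begin

section \<open>Root systems and reflection groups\<close>

text \<open>Formula for the reflection in the hyperplane orthogonal to a root of squared length \<open>2\<close>.\<close>

definition reflection :: "'a::euclidean_space \<Rightarrow> 'a \<Rightarrow> 'a" where
  "reflection \<alpha> x = x - (\<alpha> \<bullet> x) *\<^sub>R \<alpha>"

definition root_system :: "'a::euclidean_space set \<Rightarrow> bool" where
  "root_system R \<longleftrightarrow>
     finite R \<and> 0 \<notin> R \<and> span R = UNIV \<and>
     (\<forall>\<alpha>\<in>R. \<alpha> \<bullet> \<alpha> = 2) \<and>
     (\<forall>\<alpha>\<in>R. reflection \<alpha> ` R = R) \<and>
     (\<forall>\<alpha>\<in>R. R \<inter> range (\<lambda>c::real. c *\<^sub>R \<alpha>) = {\<alpha>, - \<alpha>})"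

definition regular_set :: "'a::euclidean_space set \<Rightarrow> 'a set" where
  "regular_set R = {x. \<forall>\<alpha>\<in>R. \<alpha> \<bullet> x \<noteq> 0}"

definition positive_roots :: "'a::euclidean_space set \<Rightarrow> 'a set \<Rightarrow> bool" where
  "positive_roots R Rp \<longleftrightarrow> (\<exists>c\<in>regular_set R. Rp = {\<alpha>\<in>R. \<alpha> \<bullet> c > 0})"

text \<open>Reflections are involutions, so closure under composition already yields the generated group.\<close>

inductive_set reflection_group :: "'a::euclidean_space set \<Rightarrow> ('a \<Rightarrow> 'a) set" for R where
  id: "id \<in> reflection_group R"
| comp: "\<alpha> \<in> R \<Longrightarrow> w \<in> reflection_group R \<Longrightarrow> reflection \<alpha> \<circ> w \<in> reflection_group R"

definition invariant_multiplicity :: "'a::euclidean_space set \<Rightarrow> ('a \<Rightarrow> complex) \<Rightarrow> bool" where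
  "invariant_multiplicity R k \<longleftrightarrow> (\<forall>w\<in>reflection_group R. \<forall>\<alpha>\<in>R. k (w \<alpha>) = k \<alpha>)"

section \<open>The complexification\<close>

text \<open>The pair \<open>(a, b)\<close> stands for \<open>a + \<i> b\<close>. The real normed structure is the one of the
  product type; multiplication by the imaginary unit is \<open>times_i\<close>.\<close>

type_synonym 'a complexified = "'a \<times> 'a"

definition real_point :: "'a::euclidean_space \<Rightarrow> 'a complexified" where
  "real_point x = (x, 0)"

definition times_i :: "'a::euclidean_space complexified \<Rightarrow> 'a complexified" where
  "times_i z = (- snd z, fst z)"

text \<open>The complex bilinear (not sesquilinear) extension of the inner product.\<close>

definition cinner :: "'a::euclidean_space complexified \<Rightarrow> 'a complexified \<Rightarrow> complex" where
  "cinner z u = Complex (fst z \<bullet> fst u - snd z \<bullet> snd u) (fst z \<bullet> snd u + snd z \<bullet> fst u)"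

text \<open>The complex linear extension of a real linear map.\<close>

definition complexify_map :: "('a \<Rightarrow> 'a) \<Rightarrow> 'a complexified \<Rightarrow> 'a::euclidean_space complexified" where
  "complexify_map w z = (w (fst z), w (snd z))"

text \<open>Joint holomorphy: the Frechet derivative exists everywhere and is complex linear.\<close>

definition entire2 :: "('a::euclidean_space complexified \<Rightarrow> 'a complexified \<Rightarrow> complex) \<Rightarrow> bool" where
  "entire2 E \<longleftrightarrow>
     (\<forall>z. \<exists>D. ((\<lambda>(l, x). E l x) has_derivative D) (at z) \<and>
        (\<forall>h1 h2. D (times_i h1, times_i h2) = \<i> * D (h1, h2)))"

section \<open>Constant coefficient differential operators\<close>

definition dir_deriv :: "'a::euclidean_space \<Rightarrow> ('a \<Rightarrow> complex) \<Rightarrow> 'a \<Rightarrow> complex" where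
  "dir_deriv \<xi> f x = vector_derivative (\<lambda>t. f (x + t *\<^sub>R \<xi>)) (at 0)"

text \<open>\<open>diff_op_of p P\<close> states that \<open>P\<close> is the operator \<open>p(\<partial>)\<close>: the graph of the algebra
  homomorphism that sends \<open>\<langle>\<xi>, \<cdot>\<rangle>\<close> to the directional derivative along \<open>\<xi>\<close>. It is
  a relation because \<open>P\<close> acts on arbitrary functions: operators related to the same \<open>p\<close> agree on
  smooth functions, but may differ where derivatives do not exist.\<close>

inductive diff_op_of ::
    "('a::euclidean_space \<Rightarrow> complex) \<Rightarrow> (('a \<Rightarrow> complex) \<Rightarrow> 'a \<Rightarrow> complex) \<Rightarrow> bool" where
  const: "diff_op_of (\<lambda>x. c) (\<lambda>f x. c * f x)"
| linear: "diff_op_of (\<lambda>x. of_real (\<xi> \<bullet> x)) (dir_deriv \<xi>)"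
| add: "diff_op_of p P \<Longrightarrow> diff_op_of q Q \<Longrightarrow>
    diff_op_of (\<lambda>x. p x + q x) (\<lambda>f x. P f x + Q f x)"
| mult: "diff_op_of p P \<Longrightarrow> diff_op_of q Q \<Longrightarrow>
    diff_op_of (\<lambda>x. p x * q x) (\<lambda>f. P (Q f))"

lemma diff_op_of_exists_real:
  fixes p :: "'a::euclidean_space \<Rightarrow> real"
  assumes "real_polynomial_function p"
  shows "\<exists>P. diff_op_of (\<lambda>x. complex_of_real (p x)) P"
  using assms
proof induction
  case (linear f)
  have "f x = adjoint f 1 \<bullet> x" for x
    using adjoint_works[OF bounded_linear.linear[OF linear], of x 1] by (simp add: inner_commute)
  then show ?case
    using diff_op_of.linear[of "adjoint f 1"] by (intro exI) simp
next
  case (const c)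
  show ?case by (rule exI, rule diff_op_of.const)
next
  case (add f g)
  then obtain P Q where "diff_op_of (\<lambda>x. complex_of_real (f x)) P"
    "diff_op_of (\<lambda>x. complex_of_real (g x)) Q" by blast
  from diff_op_of.add[OF this] show ?case by (intro exI) simp
next
  case (mult f g)
  then obtain P Q where "diff_op_of (\<lambda>x. complex_of_real (f x)) P"
    "diff_op_of (\<lambda>x. complex_of_real (g x)) Q" by blast
  from diff_op_of.mult[OF this] show ?case by (intro exI) simp
qed

lemma diff_op_of_exists:
  fixes p :: "'a::euclidean_space \<Rightarrow> complex"
  assumes "polynomial_function p"
  shows "\<exists>P. diff_op_of p P"
proof -
  have "real_polynomial_function (Re \<circ> p)" "real_polynomial_function (Im \<circ> p)"
    using assms bounded_linear_Re bounded_linear_Im unfolding polynomial_function_def by blast+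
  then obtain P Q where PQ: "diff_op_of (\<lambda>x. complex_of_real (Re (p x))) P"
    "diff_op_of (\<lambda>x. complex_of_real (Im (p x))) Q"
    using diff_op_of_exists_real[of "Re \<circ> p"] diff_op_of_exists_real[of "Im \<circ> p"]
    by (auto simp: comp_def)
  have "\<exists>P. diff_op_of (\<lambda>x. complex_of_real (Re (p x)) + \<i> * complex_of_real (Im (p x))) P"
    by (rule exI, rule diff_op_of.add[OF PQ(1) diff_op_of.mult[OF diff_op_of.const PQ(2)]])
  then show ?thesis by (simp flip: complex_eq)
qed

section \<open>Dunkl operators and the Dunkl kernel\<close>

text \<open>The quotient \<open>(f(x) - f(s\<^sub>\<alpha> x)) / \<langle>\<alpha>, x\<rangle>\<close>, extended to the hyperplane
  \<open>\<langle>\<alpha>, x\<rangle> = 0\<close> by continuity: for \<open>f\<close> of class \<open>C\<^sup>1\<close> its limit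
  there is the derivative of \<open>f\<close> along \<open>\<alpha>\<close>.\<close>

definition reflection_quotient :: "'a::euclidean_space \<Rightarrow> ('a \<Rightarrow> complex) \<Rightarrow> 'a \<Rightarrow> complex" where
  "reflection_quotient \<alpha> f x =
     (if \<alpha> \<bullet> x = 0 then dir_deriv \<alpha> f x
      else (f x - f (reflection \<alpha> x)) / of_real (\<alpha> \<bullet> x))"

definition dunkl_op ::
    "'a::euclidean_space set \<Rightarrow> ('a \<Rightarrow> complex) \<Rightarrow> 'a \<Rightarrow> ('a \<Rightarrow> complex) \<Rightarrow> 'a \<Rightarrow> complex" where
  "dunkl_op Rp k \<xi> f x =
     dir_deriv \<xi> f x + (\<Sum>\<alpha>\<in>Rp. k \<alpha> * of_real (\<alpha> \<bullet> \<xi>) * reflection_quotient \<alpha> f x)"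

text \<open>The kernel is entire on \<open>\<aa>\<^sub>C \<times> \<aa>\<^sub>C\<close>, so by the identity theorem it suffices to
  impose the eigenvalue equations at real points \<open>x\<close>.\<close>

definition is_dunkl_kernel ::
    "'a::euclidean_space set \<Rightarrow> ('a \<Rightarrow> complex) \<Rightarrow>
      ('a complexified \<Rightarrow> 'a complexified \<Rightarrow> complex) \<Rightarrow> bool" where
  "is_dunkl_kernel Rp k E \<longleftrightarrow>
     entire2 E \<and>
     (\<forall>l. E l (real_point 0) = 1 \<and>
        (\<forall>\<xi> x. dunkl_op Rp k \<xi> (\<lambda>y. E l (real_point y)) x =
               cinner (real_point \<xi>) l * E l (real_point x)))"

definition Omega_inv_sqrt :: "'a::euclidean_space set \<Rightarrow> ('a \<Rightarrow> complex) \<Rightarrow> 'a \<Rightarrow> complex" where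
  "Omega_inv_sqrt Rp k x = (\<Prod>\<alpha>\<in>Rp. complex_of_real (1 + \<bar>\<alpha> \<bullet> x\<bar>) powr (- k \<alpha>))"

end

theory Submission
  imports Defs "HOL-Complex_Analysis.Complex_Analysis"
begin

text \<open>Along a ray, \<open>F\<^sub>w(t) = Exp\<^sub>k(\<lambda>, t w z)\<close> satisfies the finite system
  \<open>F' = D F - (1/t) \<Sum> k\<^sub>\<alpha> (1 - s\<^sub>\<alpha>) F\<close> with \<open>D\<close> diagonal. Only the
  eigenvalue equation in the radial direction enters, and it extends to complex \<open>z\<close>. The
  reflection term is dissipative in \<open>\<ell>\<^sup>2(W)\<close>, so its possibly small denominators do no
  harm. As \<open>\<lambda>\<^sub>2\<close> is regular, the entries of \<open>D\<close> that \<open>s\<^sub>\<alpha>\<close> couples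
  differ by \<open>\<langle>\<alpha>, \<lambda>\<rangle> u\<close> with \<open>u = \<langle>\<alpha>, w z\<rangle>\<close> and
  \<open>\<langle>\<alpha>, \<lambda>\<rangle> \<noteq> 0\<close>; a gauge transformation close to the identity therefore removes
  the coupling through \<open>s\<^sub>\<alpha>\<close> where \<open>t \<bar>u\<bar>\<close> is large, up to an integrable error. The
  remaining diagonal term \<open>- k\<^sub>\<alpha> / t\<close> produces the factor \<open>\<Omega>\<^sub>k\<close> to the power
  \<open>-1/2\<close>. The resulting bound on the complexification is stable under bounded complex shifts, so
  Cauchy's estimate transfers it to all derivatives.\<close>

section \<open>Complex scaling and the bilinear form\<close>

text \<open>Pairs of real vectors carry only a real vector space structure; this is complex scalar
  multiplication on the complexification.\<close>

definition cscale :: "complex \<Rightarrow> 'a::euclidean_space complexified \<Rightarrow> 'a complexified" where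
  "cscale \<zeta> h = Re \<zeta> *\<^sub>R h + Im \<zeta> *\<^sub>R times_i h"

lemma cscale_simps [simp]:
  "cscale 0 h = 0" "cscale 1 h = h" "cscale (of_real r) h = r *\<^sub>R h" "cscale \<zeta> 0 = 0"
  by (auto simp: cscale_def times_i_def zero_prod_def)

lemma cscale_add_left: "cscale (\<zeta> + \<eta>) h = cscale \<zeta> h + cscale \<eta> h"
  by (simp add: cscale_def algebra_simps)

lemma cinner_commute: "cinner z u = cinner u z"
  by (auto simp: cinner_def complex_eq_iff inner_commute)

lemma cinner_add_left: "cinner (z + u) v = cinner z v + cinner u v"
  by (auto simp: cinner_def complex_eq_iff inner_add_left)

lemma cinner_add_right: "cinner v (z + u) = cinner v z + cinner v u"
  by (simp add: cinner_commute[of v] cinner_add_left)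

lemma cinner_cscale_left: "cinner (cscale \<zeta> z) u = \<zeta> * cinner z u"
  by (auto simp: cinner_def cscale_def times_i_def complex_eq_iff algebra_simps)

lemma cinner_cscale_right: "cinner u (cscale \<zeta> z) = \<zeta> * cinner u z"
  by (simp add: cinner_commute[of u] cinner_cscale_left)

lemma continuous_on_cscale [continuous_intros]:
  assumes "continuous_on S f" "continuous_on S g"
  shows "continuous_on S (\<lambda>x. cscale (f x) (g x))"
  unfolding cscale_def times_i_def using assms by (intro continuous_intros)

section \<open>Gateaux entire functions\<close>

text \<open>Continuity plus holomorphy on every complex line characterizes entire functions in
  finite dimension. In this form both conditions pass to locally uniform limits, so the class is
  easily seen to be closed under directional derivatives.\<close>

definition gateaux_entire :: "('a::euclidean_space complexified \<Rightarrow> complex) \<Rightarrow> bool" where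
  "gateaux_entire g \<longleftrightarrow> continuous_on UNIV g \<and> (\<forall>z h. (\<lambda>\<zeta>. g (z + cscale \<zeta> h)) holomorphic_on UNIV)"

definition cdir_deriv ::
    "'a::euclidean_space complexified \<Rightarrow> ('a complexified \<Rightarrow> complex) \<Rightarrow> 'a complexified \<Rightarrow> complex" where
  "cdir_deriv h g z = deriv (\<lambda>\<zeta>. g (z + cscale \<zeta> h)) 0"

lemma gateaux_entireD:
  assumes "gateaux_entire g"
  shows "continuous_on S g" "(\<lambda>\<zeta>. g (z + cscale \<zeta> h)) holomorphic_on T"
  using assms unfolding gateaux_entire_def
  by (meson continuous_on_subset holomorphic_on_subset subset_UNIV)+

lemma gateaux_entire_cmult:
  assumes "gateaux_entire g" shows "gateaux_entire (\<lambda>z. c * g z)"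
  unfolding gateaux_entire_def
  by (intro conjI allI continuous_on_mult holomorphic_on_mult continuous_on_const holomorphic_on_const
      gateaux_entireD[OF assms])

lemma gateaux_entire_add:
  assumes "gateaux_entire f" "gateaux_entire g" shows "gateaux_entire (\<lambda>z. f z + g z)"
  unfolding gateaux_entire_def
  by (intro conjI allI continuous_on_add holomorphic_on_add gateaux_entireD[OF assms(1)] gateaux_entireD[OF assms(2)])

lemma cdir_deriv_line:
  assumes "gateaux_entire g"
  shows "((\<lambda>\<zeta>. g (z + cscale \<zeta> h)) has_field_derivative cdir_deriv h g (z + cscale \<zeta> h)) (at \<zeta>)"
proof -
  let ?q = "\<lambda>\<zeta>. g (z + cscale \<zeta> h)"
  have d: "(?q has_field_derivative deriv ?q \<zeta>) (at \<zeta>)"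
    using gateaux_entireD(2)[OF assms] by (intro holomorphic_derivI[of _ UNIV]) auto
  have "((\<lambda>\<eta>. ?q (\<zeta> + \<eta>)) has_field_derivative deriv ?q \<zeta>) (at 0)"
    using d DERIV_shift[of ?q "deriv ?q \<zeta>" 0 \<zeta>] by (simp add: add.commute)
  then have "deriv (\<lambda>\<eta>. ?q (\<zeta> + \<eta>)) 0 = deriv ?q \<zeta>" by (rule DERIV_imp_deriv)
  then have "cdir_deriv h g (z + cscale \<zeta> h) = deriv ?q \<zeta>"
    by (simp add: cdir_deriv_def cscale_add_left add.assoc)
  with d show ?thesis by simp
qed

lemma cdir_deriv_eqI:
  assumes "((\<lambda>\<zeta>. g (z + cscale \<zeta> h)) has_field_derivative d) (at 0)"
  shows "cdir_deriv h g z = d"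
  using assms by (simp add: cdir_deriv_def DERIV_imp_deriv)

section \<open>Cauchy estimates and closure under complex directional derivatives\<close>

lemma norm_cdir_deriv_le:
  assumes "gateaux_entire g" "\<And>s. cmod s = 1 \<Longrightarrow> cmod (g (z + cscale s h)) \<le> B"
  shows "cmod (cdir_deriv h g z) \<le> B"
proof -
  \<comment> \<open>Cauchy's inequality on the unit circle in the direction \<open>h\<close>; radius
    one matches the unit shifts in \<open>kernel_growth_slowly_varying\<close>.\<close>
  have "cmod ((deriv ^^ 1) (\<lambda>\<zeta>. g (z + cscale \<zeta> h)) 0) \<le> fact 1 * B / 1 ^ 1"
    using gateaux_entireD(2)[OF assms(1)] assms(2)
    by (intro Cauchy_inequality holomorphic_on_imp_continuous_on) auto
  then show ?thesis by (simp add: cdir_deriv_def)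
qed

text \<open>Circles of radius 1/2 about points of the disc of radius 1/2 stay in the unit disc, so
  Cauchy bounds the second derivative there by \<open>2 * B / (1/2)^2 = 8 * B\<close>. Dividing the
  first order Taylor remainder by \<open>s\<close> leaves one factor \<open>cmod s\<close>.\<close>

lemma difference_quotient_bound:
  assumes hol: "q holomorphic_on UNIV" and B: "\<And>s. cmod s \<le> 1 \<Longrightarrow> cmod (q s) \<le> B"
    and s: "s \<noteq> 0" "cmod s \<le> 1 / 2"
  shows "cmod ((q s - q 0) / s - deriv q 0) \<le> 8 * B * cmod s"
proof -
  have "cmod ((deriv ^^ 0) q s - (\<Sum>i\<le>1. (deriv ^^ i) q 0 * (s - 0) ^ i / fact i))
      \<le> (8 * B) * cmod (s - 0) ^ Suc 1 / fact 1"
  proof (rule complex_Taylor[of "cball 0 (1/2)"])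
    show "((deriv ^^ i) q has_field_derivative (deriv ^^ Suc i) q x) (at x within cball 0 (1/2))" for i x
      using holomorphic_derivI[OF holomorphic_higher_deriv[OF hol open_UNIV] open_UNIV UNIV_I]
      by (simp add: has_field_derivative_at_within)
    show "cmod ((deriv ^^ Suc 1) q x) \<le> 8 * B" if "x \<in> cball 0 (1/2)" for x
    proof -
      have "cmod ((deriv ^^ Suc 1) q x) \<le> fact (Suc 1) * B / (1/2) ^ Suc 1"
      proof (rule Cauchy_inequality)
        fix y assume "cmod (x - y) = 1 / 2"
        then have "cmod y \<le> 1" using that norm_triangle_ineq3[of x y] by (simp add: abs_le_iff)
        then show "cmod (q y) \<le> B" by (rule B)
      qed (simp_all add: holomorphic_on_imp_continuous_on holomorphic_on_subset[OF hol subset_UNIV])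
      then show ?thesis by (simp add: numeral_2_eq_2)
    qed
  qed (use s in auto)
  then have "cmod (q s - q 0 - deriv q 0 * s) \<le> 8 * B * cmod s * cmod s"
    by (simp add: power2_eq_square diff_diff_eq mult.assoc)
  moreover have "(q s - q 0) / s - deriv q 0 = (q s - q 0 - deriv q 0 * s) / s"
    using s by (simp add: diff_divide_distrib)
  ultimately show ?thesis using s by (simp add: norm_divide field_simps)
qed

text \<open>Moving a compact set by all \<open>cscale s h\<close> with \<open>cmod s\<close> \<le> 1
  keeps it compact, so one bound \<open>B\<close> serves all base points. The index
  \<open>n + 2\<close> keeps every step at most 1/2, as the quotient estimate requires.\<close>

lemma difference_quotients_uniform_limit:
  assumes g: "gateaux_entire g" and S: "compact S"
  shows "uniform_limit S (\<lambda>n z. (g (z + cscale (of_real (1 / real (n + 2))) h) - g z) / of_real (1 / real (n + 2)))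
    (cdir_deriv h g) sequentially"
proof -
  have "compact ((\<lambda>(z, s). z + cscale s h) ` (S \<times> cball 0 1))"
    unfolding case_prod_beta by (intro compact_continuous_image compact_Times S continuous_intros) auto
  then have "bounded (g ` (\<lambda>(z, s). z + cscale s h) ` (S \<times> cball 0 1))"
    by (rule compact_imp_bounded[OF compact_continuous_image[OF gateaux_entireD(1)[OF g]]])
  then obtain B where B: "\<And>z s. z \<in> S \<Longrightarrow> cmod s \<le> 1 \<Longrightarrow> cmod (g (z + cscale s h)) \<le> B"
    unfolding bounded_iff by force
  have le: "cmod ((g (z + cscale (of_real (1 / real (n + 2))) h) - g z) / of_real (1 / real (n + 2)) - cdir_deriv h g z)
      \<le> 8 * B * (1 / real (n + 2))" if "z \<in> S" for z n
    using difference_quotient_bound[OF gateaux_entireD(2)[OF g], of z h B "of_real (1 / real (n + 2))"] B[OF that]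
    by (simp add: cdir_deriv_def norm_divide field_simps del: of_real_divide cscale_simps(3)) 
  have "(\<lambda>n. 8 * B * (1 / real (n + 2))) \<longlonglongrightarrow> 8 * B * 0"
    by (intro tendsto_mult_left LIMSEQ_ignore_initial_segment[of "\<lambda>n. 1 / real n"] lim_1_over_n)
  then have lim: "(\<lambda>n. 8 * B * (1 / real (n + 2))) \<longlonglongrightarrow> 0" by simp
  show ?thesis
  proof (rule uniform_limitI)
    fix e :: real assume "e > 0"
    from order_tendstoD(2)[OF lim this]
    show "\<forall>\<^sub>F n in sequentially. \<forall>z\<in>S. dist ((g (z + cscale (of_real (1 / real (n + 2))) h) - g z) / of_real (1 / real (n + 2)))
        (cdir_deriv h g z) < e"
      unfolding dist_norm by eventually_elim (blast intro: le_less_trans[OF le])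
  qed
qed

text \<open>The derivative is a locally uniform limit of difference quotients of \<open>g\<close>.
  These are continuous and holomorphic along every line, in any direction \<open>h'\<close>, and
  both properties survive the limit.\<close>

lemma gateaux_entire_cdir_deriv:
  assumes g: "gateaux_entire g"
  shows "gateaux_entire (cdir_deriv h g)"
proof -
  let ?g = "\<lambda>n z. (g (z + cscale (of_real (1 / real (n + 2))) h) - g z) / of_real (1 / real (n + 2))"
  have nz: "complex_of_real (1 / real (n + 2)) \<noteq> 0" for n unfolding of_real_eq_0_iff by simp
  have shift: "continuous_on S (\<lambda>z. g (z + a))" for S a
    by (rule continuous_on_compose2[OF gateaux_entireD(1)[OF g, of UNIV]]) (auto intro: continuous_intros)
  have cont_n: "continuous_on S (?g n)" for S n
    by (intro continuous_on_divide continuous_on_diff shift gateaux_entireD(1)[OF g] continuous_on_const ballI nz)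
  have "continuous_on UNIV (cdir_deriv h g)"
  proof -
    have "isCont (cdir_deriv h g) z" for z
    proof -
      have "continuous_on (cball z 1) (cdir_deriv h g)"
        by (rule uniform_limit_theorem[OF always_eventually[OF allI[OF cont_n]]
              difference_quotients_uniform_limit[OF g compact_cball] sequentially_bot])
      then show ?thesis by (rule continuous_on_interior) simp
    qed
    then show ?thesis by (simp add: continuous_at_imp_continuous_on)
  qed
  moreover have "(\<lambda>\<zeta>. cdir_deriv h g (z + cscale \<zeta> h')) holomorphic_on UNIV" for z h'
  proof (rule holomorphic_uniform_sequence)
    show "(\<lambda>\<zeta>. ?g n (z + cscale \<zeta> h')) holomorphic_on UNIV" for n
    proof -
      have "(\<lambda>\<zeta>. g ((z + cscale \<zeta> h') + a)) holomorphic_on UNIV" for a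
        using gateaux_entireD(2)[OF g, of "z + a" h' UNIV] by (simp add: add_ac)
      then show ?thesis
        by (intro holomorphic_on_divide holomorphic_on_diff gateaux_entireD(2)[OF g] holomorphic_on_const nz)
    qed
    fix \<zeta> :: complex
    have "compact ((\<lambda>\<zeta>. z + cscale \<zeta> h') ` cball \<zeta> 1)"
      by (intro compact_continuous_image continuous_intros) auto
    from difference_quotients_uniform_limit[OF g this, of h]
    have "uniform_limit (cball \<zeta> 1) (\<lambda>n \<zeta>. ?g n (z + cscale \<zeta> h')) (\<lambda>\<zeta>. cdir_deriv h g (z + cscale \<zeta> h')) sequentially"
      unfolding uniform_limit_iff by simp
    then show "\<exists>d>0. cball \<zeta> d \<subseteq> UNIV \<and>
        uniform_limit (cball \<zeta> d) (\<lambda>n \<zeta>. ?g n (z + cscale \<zeta> h')) (\<lambda>\<zeta>. cdir_deriv h g (z + cscale \<zeta> h')) sequentially"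
      by (intro exI[of _ 1]) auto
  qed simp
  ultimately show ?thesis by (simp add: gateaux_entire_def)
qed

lemma real_point_add_scaleR: "real_point (x + t *\<^sub>R \<xi>) = real_point x + cscale (of_real t) (real_point \<xi>)"
  by (simp add: real_point_def)

lemma dir_deriv_real_point:
  assumes "gateaux_entire g"
  shows "dir_deriv \<xi> (\<lambda>y. g (real_point y)) x = cdir_deriv (real_point \<xi>) g (real_point x)"
proof -
  have "((\<lambda>t. g (real_point x + cscale (of_real t) (real_point \<xi>))) has_vector_derivative
      cdir_deriv (real_point \<xi>) g (real_point x + cscale (of_real 0) (real_point \<xi>))) (at 0)"
    by (rule cdir_deriv_line[OF assms, THEN has_vector_derivative_real_field])
  then show ?thesis
    unfolding dir_deriv_def real_point_add_scaleR by (simp add: vector_derivative_at)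
qed

section \<open>Slices of a jointly entire kernel in the second variable\<close>

lemma entire2_slice_derivative:
  fixes E :: "'a::euclidean_space complexified \<Rightarrow> 'a complexified \<Rightarrow> complex"
  assumes "entire2 E"
  shows "\<exists>D :: 'a complexified \<times> 'a complexified \<Rightarrow> complex. bounded_linear D \<and> (\<forall>h a. D (0, cscale a h) = a * D (0, h)) \<and>
    (E l has_derivative (\<lambda>h. D (0, h))) (at z) \<and>
    (\<forall>h. ((\<lambda>\<zeta>. E l (z + cscale \<zeta> h)) has_field_derivative D (0, h)) (at 0))"
proof -
  obtain D where D: "((\<lambda>(l, x). E l x) has_derivative D) (at (l, z))"
    and Di: "\<And>h1 h2. D (times_i h1, times_i h2) = \<i> * D (h1, h2)"
    using assms[unfolded entire2_def, THEN spec, of "(l, z)"] by metis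
  have bl: "bounded_linear D" using D by (rule has_derivative_bounded_linear)
  then have lin: "linear D" by (rule bounded_linear.linear)
  have cl: "D (0, cscale a h) = a * D (0, h)" for a h
  proof -
    \<comment> \<open>As \<open>times_i 0 = 0\<close>, the joint complex linearity of
      \<open>D\<close> restricts to increments of the second variable alone.\<close>
    have "D (0, times_i h) = \<i> * D (0, h)" using Di[of 0 h] by (simp add: times_i_def zero_prod_def)
    moreover have "(0, cscale a h) = Re a *\<^sub>R (0, h) + Im a *\<^sub>R (0, times_i h)" by (simp add: cscale_def)
    then have "D (0, cscale a h) = Re a *\<^sub>R D (0, h) + Im a *\<^sub>R D (0, times_i h)"
      unfolding linear_add[OF lin, symmetric] linear_scale[OF lin, symmetric] by simp
    ultimately show ?thesis by (simp add: complex_eq_iff algebra_simps)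
  qed
  have pair: "((\<lambda>x. (l, x)) has_derivative (\<lambda>h. (0, h))) (at z)"
    by (intro has_derivative_Pair has_derivative_const has_derivative_ident)
  have 1: "(E l has_derivative (\<lambda>h. D (0, h))) (at z)"
    using diff_chain_at[OF pair D] by (simp add: o_def)
  have 2: "((\<lambda>\<zeta>. E l (z + cscale \<zeta> h)) has_field_derivative D (0, h)) (at 0)" for h
  proof -
    have line: "((\<lambda>\<zeta>. z + cscale \<zeta> h) has_derivative (\<lambda>\<eta>. cscale \<eta> h)) (at 0)"
      unfolding cscale_def by (auto intro!: derivative_eq_intros)
    have "(E l has_derivative (\<lambda>h. D (0, h))) (at (z + cscale 0 h))" using 1 by simp
    from diff_chain_at[OF line this]
    have "((\<lambda>\<zeta>. E l (z + cscale \<zeta> h)) has_derivative (\<lambda>\<eta>. \<eta> * D (0, h))) (at 0)"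
      unfolding o_def cl .
    then show ?thesis
      unfolding has_field_derivative_def by (rule has_derivative_eq_rhs) (simp add: fun_eq_iff)
  qed
  show ?thesis by (intro exI[of _ D] conjI allI bl cl 1 2)
qed

lemma entire2_imp_gateaux_entire:
  assumes "entire2 E"
  shows "gateaux_entire (E l)"
  unfolding gateaux_entire_def
proof (intro conjI allI)
  have "isCont (E l) z" for z
    using entire2_slice_derivative[OF assms, of l z] by (elim exE conjE) (rule has_derivative_continuous)
  then show "continuous_on UNIV (E l)" by (intro continuous_at_imp_continuous_on ballI)
  fix z h :: "'a complexified"
  have "(\<lambda>\<zeta>. E l (z + cscale \<zeta> h)) field_differentiable at \<zeta>" for \<zeta>
  proof -
    obtain d where "((\<lambda>\<eta>. E l ((z + cscale \<zeta> h) + cscale \<eta> h)) has_field_derivative d) (at 0)"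
      using entire2_slice_derivative[OF assms, of l "z + cscale \<zeta> h"] by (elim exE conjE) (rule that, erule spec)
    then have "((\<lambda>\<zeta>. E l (z + cscale \<zeta> h)) has_field_derivative d) (at \<zeta>)"
      using DERIV_shift[of "\<lambda>\<zeta>. E l (z + cscale \<zeta> h)" d 0 \<zeta>]
      by (simp add: cscale_add_left add_ac)
    then show ?thesis unfolding field_differentiable_def by (rule exI)
  qed
  then show "(\<lambda>\<zeta>. E l (z + cscale \<zeta> h)) holomorphic_on UNIV"
    by (simp add: holomorphic_on_def)
qed

text \<open>Linearity in the direction is inherited from the Frechet derivative. It serves the Euler
  equation, whose direction is the base point: it splits \<open>a + cscale \<zeta> b\<close> and
  pulls the factor \<open>t\<close> out of a direction.\<close>

lemma cdir_deriv_linear: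
  fixes E :: "'a::euclidean_space complexified \<Rightarrow> 'a complexified \<Rightarrow> complex"
  assumes "entire2 E"
  shows "cdir_deriv (cscale a h + cscale b h') (E l) z = a * cdir_deriv h (E l) z + b * cdir_deriv h' (E l) z"
proof -
  obtain D :: "'a complexified \<times> 'a complexified \<Rightarrow> complex" where D: "bounded_linear D" "\<forall>h a. D (0, cscale a h) = a * D (0, h)"
     "\<forall>h. ((\<lambda>\<zeta>. E l (z + cscale \<zeta> h)) has_field_derivative D (0, h)) (at 0)"
    using entire2_slice_derivative[OF assms, of l z] by (elim exE conjE) (rule that; assumption)
  have "D (0, cscale a h + cscale b h') = D ((0, cscale a h) + (0, cscale b h'))" by simp
  also have "\<dots> = a * D (0, h) + b * D (0, h')"
    unfolding linear_add[OF bounded_linear.linear[OF D(1)]] D(2)[rule_format] ..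
  finally show ?thesis unfolding cdir_deriv_eqI[OF D(3)[rule_format]] .
qed

section \<open>Linear systems coupled by involutions\<close>

text \<open>The function \<open>V t * exp (- P t)\<close> is nonincreasing. Differentiability is
  asked only inside the interval because the system is singular at its left end; continuity bridges
  the endpoints.\<close>

lemma gronwall_open:
  fixes V P :: "real \<Rightarrow> real"
  assumes "a \<le> b" and V: "continuous_on {a..b} V" and P: "continuous_on {a..b} P"
    and V': "\<And>t. a < t \<Longrightarrow> t < b \<Longrightarrow> (V has_real_derivative V' t) (at t)"
    and P': "\<And>t. a < t \<Longrightarrow> t < b \<Longrightarrow> (P has_real_derivative P' t) (at t)"
    and le: "\<And>t. a < t \<Longrightarrow> t < b \<Longrightarrow> V' t \<le> P' t * V t"
  shows "V b \<le> V a * exp (P b - P a)"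
proof -
  have "V a * exp (- P a) \<ge> V b * exp (- P b)"
  proof (rule DERIV_nonpos_imp_decreasing_open[OF \<open>a \<le> b\<close>])
    fix t assume t: "a < t" "t < b"
    have "((\<lambda>t. V t * exp (- P t)) has_real_derivative (V' t - P' t * V t) * exp (- P t)) (at t)"
      by (auto intro!: derivative_eq_intros V'[OF t] P'[OF t] simp: algebra_simps)
    moreover have "(V' t - P' t * V t) * exp (- P t) \<le> 0"
      using le[OF t] by (simp add: mult_le_0_iff)
    ultimately show "\<exists>y. ((\<lambda>t. V t * exp (- P t)) has_real_derivative y) (at t) \<and> y \<le> 0" by blast
  qed (intro continuous_intros V P)
  then have "V b * exp (- P b) * exp (P b) \<le> V a * exp (- P a) * exp (P b)"
    by (intro mult_right_mono) auto
  then show ?thesis by (simp add: mult.assoc flip: exp_add)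
qed

text \<open>Pairing \<open>w\<close> with \<open>\<tau> w\<close> turns the off-diagonal part into a sum of
  squares, which is why complex \<open>\<kappa>\<close> with nonnegative real part is allowed.\<close>

lemma involution_dissipative:
  fixes G :: "'w \<Rightarrow> complex" and s :: "'w \<Rightarrow> real"
  assumes \<tau>: "\<And>w. w \<in> W \<Longrightarrow> \<tau> w \<in> W \<and> \<tau> (\<tau> w) = w"
    and s: "\<And>w. w \<in> W \<Longrightarrow> s (\<tau> w) = s w \<and> s w \<le> 1" and \<kappa>: "Re \<kappa> \<ge> 0"
  shows "(\<Sum>w\<in>W. Re \<kappa> * s w * (cmod (G w))\<^sup>2)
    \<le> Re (\<Sum>w\<in>W. cnj (G w) * (\<kappa> * (G w - of_real (1 - s w) * G (\<tau> w))))"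
proof -
  define X where "X = (\<Sum>w\<in>W. of_real (1 - s w) * cnj (G w) * (G w - G (\<tau> w)))"
  have "X = (\<Sum>w\<in>W. of_real (1 - s w) * cnj (G (\<tau> w)) * (G (\<tau> w) - G w))"
    unfolding X_def by (rule sum.reindex_bij_witness[of _ \<tau> \<tau>]) (use \<tau> s in auto)
  then have "2 * X = (\<Sum>w\<in>W. of_real (1 - s w) * cnj (G w) * (G w - G (\<tau> w)))
      + (\<Sum>w\<in>W. of_real (1 - s w) * cnj (G (\<tau> w)) * (G (\<tau> w) - G w))"
    using X_def by simp
  also have "\<dots> = (\<Sum>w\<in>W. of_real ((1 - s w) * (cmod (G w - G (\<tau> w)))\<^sup>2))"
    unfolding sum.distrib[symmetric]
    by (rule sum.cong) (auto simp: of_real_mult complex_norm_square algebra_simps simp del: of_real_power)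
  finally have X: "2 * X = of_real (\<Sum>w\<in>W. (1 - s w) * (cmod (G w - G (\<tau> w)))\<^sup>2)" by simp
  then have X': "X = of_real ((\<Sum>w\<in>W. (1 - s w) * (cmod (G w - G (\<tau> w)))\<^sup>2) / 2)"
    by (simp add: field_simps)
  have "(\<Sum>w\<in>W. (1 - s w) * (cmod (G w - G (\<tau> w)))\<^sup>2) \<ge> 0"
    using s by (intro sum_nonneg) simp
  then have "Re (\<kappa> * X) \<ge> 0" unfolding X' using \<kappa> by simp
  \<comment> \<open>Splits \<open>G w - (1 - s w) G (\<tau> w)\<close> as
    \<open>s w G w + (1 - s w) (G w - G (\<tau> w))\<close>; the second part contributes
    \<open>\<kappa> * X\<close>, whose real part is nonnegative.\<close>
  moreover have "(\<Sum>w\<in>W. cnj (G w) * (\<kappa> * (G w - of_real (1 - s w) * G (\<tau> w))))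
      = \<kappa> * X + (\<Sum>w\<in>W. \<kappa> * of_real (s w * (cmod (G w))\<^sup>2))"
    unfolding X_def sum_distrib_left sum.distrib[symmetric]
    by (rule sum.cong) (auto simp: of_real_mult complex_norm_square algebra_simps simp del: of_real_power)
  moreover have "Re (\<Sum>w\<in>W. \<kappa> * of_real (s w * (cmod (G w))\<^sup>2)) = (\<Sum>w\<in>W. Re \<kappa> * s w * (cmod (G w))\<^sup>2)"
    by (simp add: mult.assoc)
  ultimately show ?thesis by simp
qed

text \<open>At an index where \<open>cmod (F w)\<close> is largest, the perturbation is at most half
  of that value. So the inverse of the gauge transformation has sup norm at most 2, and squaring
  gives the factor 4. This recovers \<open>F\<close> from the gauged \<open>G\<close>.\<close>

lemma perturbed_identity_bound:
  fixes F :: "'w \<Rightarrow> complex" and b :: "'r \<Rightarrow> 'w \<Rightarrow> complex"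
  assumes "finite W" and \<tau>: "\<And>a w. a \<in> A \<Longrightarrow> w \<in> W \<Longrightarrow> \<tau> a w \<in> W"
    and b: "\<And>w. w \<in> W \<Longrightarrow> (\<Sum>a\<in>A. cmod (b a w)) \<le> 1 / 2"
    and w: "w \<in> W"
  shows "(cmod (F w))\<^sup>2 \<le> 4 * (\<Sum>w\<in>W. (cmod (F w + (\<Sum>a\<in>A. b a w * F (\<tau> a w))))\<^sup>2)"
proof -
  have "finite ((\<lambda>w. cmod (F w)) ` W)" "(\<lambda>w. cmod (F w)) ` W \<noteq> {}" using assms by auto
  then obtain w1 where w1: "w1 \<in> W" "\<And>w. w \<in> W \<Longrightarrow> cmod (F w) \<le> cmod (F w1)"
    using Max_in Max_ge by (smt (verit, best) imageE imageI)
  let ?B = "\<Sum>a\<in>A. b a w1 * F (\<tau> a w1)"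
  have "cmod ?B \<le> (\<Sum>a\<in>A. cmod (b a w1) * cmod (F w1))"
    using w1 \<tau> by (intro sum_norm_le) (auto simp: norm_mult intro!: mult_left_mono)
  also have "\<dots> \<le> 1 / 2 * cmod (F w1)"
    unfolding sum_distrib_right[symmetric] using b[OF w1(1)] by (intro mult_right_mono) auto
  finally have "cmod (F w1) \<le> 2 * cmod (F w1 + ?B)"
    using norm_diff_ineq[of "F w1" ?B] by simp
  then have "cmod (F w) \<le> 2 * cmod (F w1 + ?B)" using w1(2)[OF w] by simp
  then have "(cmod (F w))\<^sup>2 \<le> (2 * cmod (F w1 + ?B))\<^sup>2" by (intro power_mono) auto
  also have "\<dots> = 4 * (cmod (F w1 + ?B))\<^sup>2" by (simp add: power_mult_distrib)
  also have "(cmod (F w1 + ?B))\<^sup>2 \<le> (\<Sum>w\<in>W. (cmod (F w + (\<Sum>a\<in>A. b a w * F (\<tau> a w))))\<^sup>2)"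
    by (rule member_le_sum[where f = "\<lambda>w. (cmod (F w + (\<Sum>a\<in>A. b a w * F (\<tau> a w))))\<^sup>2"])
       (use assms w1 in auto)
  finally show ?thesis by simp
qed

text \<open>The commutator of \<open>D\<close> with the gauge transformation
  \<open>1 + b\<close> cancels the part \<open>s\<close> of the coupling \<open>k / t\<close>.\<close>

lemma gauged_energy_derivative:
  fixes F dF D :: "'w \<Rightarrow> complex" and W :: "'w set" and A :: "'r set" and \<tau> :: "'r \<Rightarrow> 'w \<Rightarrow> 'w"
    and k :: "'r \<Rightarrow> complex" and b b' :: "'r \<Rightarrow> 'w \<Rightarrow> complex"
    and s :: "'r \<Rightarrow> 'w \<Rightarrow> real"
  defines "G \<equiv> \<lambda>w. F w + (\<Sum>a\<in>A. b a w * F (\<tau> a w))"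
  assumes fin: "finite W" "finite A"
    and \<tau>: "\<And>a w. a \<in> A \<Longrightarrow> w \<in> W \<Longrightarrow> \<tau> a w \<in> W \<and> \<tau> a (\<tau> a w) = w"
    and s: "\<And>a w. a \<in> A \<Longrightarrow> w \<in> W \<Longrightarrow> s a (\<tau> a w) = s a w \<and> 0 \<le> s a w \<and> s a w \<le> 1"
    and k: "\<And>a. a \<in> A \<Longrightarrow> Re (k a) \<ge> 0" and t: "t > 0"
    and dF: "\<And>w. w \<in> W \<Longrightarrow> dF w = D w * F w - (\<Sum>a\<in>A. k a * (F w - F (\<tau> a w)) / of_real t)"
    and bD: "\<And>a w. a \<in> A \<Longrightarrow> w \<in> W \<Longrightarrow> b a w * (D w - D (\<tau> a w)) = k a * of_real (s a w) / of_real t"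
    and M: "\<And>w. w \<in> W \<Longrightarrow> Re (D w) \<le> M"
    and \<rho>: "\<And>w. w \<in> W \<Longrightarrow> (\<Sum>a\<in>A. Re (k a) * s a w / t) = \<rho>"
    and half: "\<And>w. w \<in> W \<Longrightarrow> (\<Sum>a\<in>A. cmod (b a w)) \<le> 1 / 2"
    and \<beta>: "\<And>w. w \<in> W \<Longrightarrow> (\<Sum>a\<in>A. cmod (b a w)) \<le> t * \<beta>"
    and \<beta>': "\<And>w. w \<in> W \<Longrightarrow> (\<Sum>a\<in>A. cmod (b' a w)) \<le> \<beta>"
  shows "(\<Sum>w\<in>W. 2 * Re (cnj (G w) * (dF w + (\<Sum>a\<in>A. b' a w * F (\<tau> a w) + b a w * dF (\<tau> a w)))))
    \<le> 2 * (M - \<rho> + 2 * card W * (4 * (\<Sum>a\<in>A. cmod (k a)) + 1) * \<beta>) * (\<Sum>w\<in>W. (cmod (G w))\<^sup>2)"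
proof -
  define V where "V = (\<Sum>w\<in>W. (cmod (G w))\<^sup>2)"
  \<comment> \<open>By \<open>perturbed_identity_bound\<close>, this bounds every
    \<open>cmod (F w)\<close>.\<close>
  define m where "m = 2 * sqrt V"
  define \<kappa> where "\<kappa> = (\<Sum>a\<in>A. cmod (k a))"
  define B where "B = (\<lambda>w. \<Sum>a\<in>A. b a w * F (\<tau> a w))"
  \<comment> \<open>\<open>S\<close> is the full coupling, while \<open>A1\<close> keeps only the
    fraction \<open>1 - s\<close> of its off-diagonal part and is the dissipative operator of
    \<open>involution_dissipative\<close>. \<open>err\<close> collects what the gauge change leaves
    over.\<close>
  define A1 where "A1 = (\<lambda>H w. \<Sum>a\<in>A. k a / of_real t * (H w - of_real (1 - s a w) * H (\<tau> a w)))"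
  define S where "S = (\<lambda>w. \<Sum>a\<in>A. k a / of_real t * (F w - F (\<tau> a w)))"
  define err where "err = (\<lambda>w. A1 B w - (\<Sum>a\<in>A. b a w * S (\<tau> a w)) + (\<Sum>a\<in>A. b' a w * F (\<tau> a w)))"
  have V0: "V \<ge> 0" unfolding V_def by (intro sum_nonneg) auto
  have \<kappa>0: "\<kappa> \<ge> 0" unfolding \<kappa>_def by (intro sum_nonneg) auto
  have GB: "G w = F w + B w" for w by (simp add: G_def B_def)
  have dF': "dF w = D w * F w - S w" if "w \<in> W" for w
    using dF[OF that] by (simp add: S_def)
  have Fm: "cmod (F w) \<le> m" if "w \<in> W" for w
  proof -
    have "(cmod (F w))\<^sup>2 \<le> 4 * V"
      unfolding V_def G_def by (rule perturbed_identity_bound) (use fin \<tau> half that in auto)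
    then have "sqrt ((cmod (F w))\<^sup>2) \<le> sqrt (4 * V)" by (rule real_sqrt_le_mono)
    then show ?thesis by (simp add: m_def real_sqrt_mult)
  qed
  have m0: "m \<ge> 0" using V0 by (simp add: m_def)
  have Bm: "cmod (B w) \<le> t * \<beta> * m" if "w \<in> W" for w
  proof -
    have "cmod (B w) \<le> (\<Sum>a\<in>A. cmod (b a w) * m)"
      unfolding B_def using that Fm \<tau> by (intro sum_norm_le) (auto simp: norm_mult intro!: mult_left_mono)
    also have "\<dots> \<le> t * \<beta> * m"
      unfolding sum_distrib_right[symmetric] using \<beta>[OF that] m0 by (intro mult_right_mono) auto
    finally show ?thesis .
  qed
  have A1m: "cmod (A1 H w) \<le> \<kappa> / t * (2 * h)" if w: "w \<in> W" and H: "\<And>w. w \<in> W \<Longrightarrow> cmod (H w) \<le> h" for H h w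
  proof -
    have "cmod (H w - of_real (1 - s a w) * H (\<tau> a w)) \<le> 2 * h" if a: "a \<in> A" for a
    proof -
      have "cmod (of_real (1 - s a w) * H (\<tau> a w)) \<le> 1 * h"
        unfolding norm_mult using s[OF a w] \<tau>[OF a w] H
        by (intro mult_mono) (auto simp del: of_real_diff)
      then show ?thesis using norm_triangle_ineq4[of "H w" "of_real (1 - s a w) * H (\<tau> a w)"] H[OF w] by simp
    qed
    then have "cmod (A1 H w) \<le> (\<Sum>a\<in>A. cmod (k a) / t * (2 * h))"
      unfolding A1_def using t
      by (intro sum_norm_le) (auto simp: norm_mult norm_divide divide_right_mono intro!: mult_left_mono divide_right_mono)
    also have "\<dots> = \<kappa> / t * (2 * h)" unfolding \<kappa>_def by (simp add: sum_divide_distrib sum_distrib_right)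
    finally show ?thesis .
  qed
  have Sm: "cmod (S w) \<le> \<kappa> / t * (2 * m)" if w: "w \<in> W" for w
  proof -
    have "cmod (F w - F (\<tau> a w)) \<le> 2 * m" if "a \<in> A" for a
      using norm_triangle_ineq4[of "F w" "F (\<tau> a w)"] Fm[OF w] Fm[of "\<tau> a w"] \<tau>[OF that w] by simp
    then have "cmod (S w) \<le> (\<Sum>a\<in>A. cmod (k a) / t * (2 * m))"
      unfolding S_def using t
      by (intro sum_norm_le) (auto simp: norm_mult norm_divide intro!: mult_left_mono divide_right_mono)
    also have "\<dots> = \<kappa> / t * (2 * m)" unfolding \<kappa>_def by (simp add: sum_divide_distrib sum_distrib_right)
    finally show ?thesis .
  qed
  \<comment> \<open>The factor \<open>t\<close> in the bound \<open>t * \<beta>\<close> on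
    \<open>b\<close> cancels the \<open>1 / t\<close> of the coupling. The two coupling terms give
    \<open>2 * \<kappa>\<close> each, and \<open>b'\<close> gives the summand 1.\<close>
  have err: "cmod (err w) \<le> (4 * \<kappa> + 1) * \<beta> * m" if w: "w \<in> W" for w
  proof -
    have 1: "cmod (A1 B w) \<le> \<kappa> / t * (2 * (t * \<beta> * m))" using A1m[OF w] Bm by blast
    have "cmod (\<Sum>a\<in>A. b a w * S (\<tau> a w)) \<le> (\<Sum>a\<in>A. cmod (b a w) * (\<kappa> / t * (2 * m)))"
      unfolding norm_mult using Sm \<tau> w by (intro sum_norm_le) (metis mult_left_mono norm_ge_zero norm_mult)
    also have "\<dots> \<le> t * \<beta> * (\<kappa> / t * (2 * m))"
      unfolding sum_distrib_right[symmetric] using \<beta>[OF w] m0 \<kappa>0 t by (intro mult_right_mono) auto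
    finally have 2: "cmod (\<Sum>a\<in>A. b a w * S (\<tau> a w)) \<le> t * \<beta> * (\<kappa> / t * (2 * m))" .
    have "cmod (\<Sum>a\<in>A. b' a w * F (\<tau> a w)) \<le> (\<Sum>a\<in>A. cmod (b' a w) * m)"
      using w Fm \<tau> by (intro sum_norm_le) (simp add: norm_mult mult_left_mono)
    also have "\<dots> \<le> \<beta> * m"
      unfolding sum_distrib_right[symmetric] using \<beta>'[OF w] m0 by (intro mult_right_mono) auto
    finally have 3: "cmod (\<Sum>a\<in>A. b' a w * F (\<tau> a w)) \<le> \<beta> * m" .
    have "cmod (err w) \<le> \<kappa> / t * (2 * (t * \<beta> * m)) + t * \<beta> * (\<kappa> / t * (2 * m)) + \<beta> * m"
      unfolding err_def
      by (rule order_trans[OF norm_triangle_ineq add_mono[OF order_trans[OF norm_triangle_ineq4 add_mono[OF 1 2]] 3]])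
    also have "\<dots> = (4 * \<kappa> + 1) * \<beta> * m" using t by (simp add: field_simps)
    finally show ?thesis .
  qed
  have A1G: "A1 G w = A1 F w + A1 B w" for w
    unfolding A1_def GB sum.distrib[symmetric] by (rule sum.cong) (auto simp: algebra_simps)
  have eq: "dF w + (\<Sum>a\<in>A. b' a w * F (\<tau> a w) + b a w * dF (\<tau> a w)) = D w * G w - A1 G w + err w"
    if w: "w \<in> W" for w
  proof -
    have dF\<tau>: "dF (\<tau> a w) = D (\<tau> a w) * F (\<tau> a w) - S (\<tau> a w)" if "a \<in> A" for a
      using dF' \<tau>[OF that w] by blast
    have "b a w * dF (\<tau> a w) = D w * (b a w * F (\<tau> a w)) - k a * of_real (s a w) / of_real t * F (\<tau> a w)
        - b a w * S (\<tau> a w)" if a: "a \<in> A" for a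
      unfolding bD[OF a w, symmetric] dF\<tau>[OF a] by (simp add: algebra_simps)
    then have "(\<Sum>a\<in>A. b a w * dF (\<tau> a w)) = (\<Sum>a\<in>A. D w * (b a w * F (\<tau> a w))
        - k a * of_real (s a w) / of_real t * F (\<tau> a w) - b a w * S (\<tau> a w))"
      by (intro sum.cong) auto
    also have "\<dots> = D w * B w - (\<Sum>a\<in>A. k a * of_real (s a w) / of_real t * F (\<tau> a w))
        - (\<Sum>a\<in>A. b a w * S (\<tau> a w))"
      by (simp add: sum_subtractf B_def sum_distrib_left)
    finally have *: "(\<Sum>a\<in>A. b a w * dF (\<tau> a w)) = \<dots>" .
    have "A1 F w = S w + (\<Sum>a\<in>A. k a * of_real (s a w) / of_real t * F (\<tau> a w))"
      unfolding A1_def S_def sum.distrib[symmetric] using t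
      by (intro sum.cong) (auto simp: field_simps)
    then show ?thesis
      unfolding sum.distrib * dF'[OF w] err_def A1G GB by (simp add: algebra_simps)
  qed
  have "(\<Sum>w\<in>W. Re (cnj (G w) * (dF w + (\<Sum>a\<in>A. b' a w * F (\<tau> a w) + b a w * dF (\<tau> a w)))))
      = (\<Sum>w\<in>W. Re (cnj (G w) * (D w * G w))) - (\<Sum>w\<in>W. Re (cnj (G w) * A1 G w))
        + (\<Sum>w\<in>W. Re (cnj (G w) * err w))"
    unfolding sum_subtractf[symmetric] sum.distrib[symmetric] 
    by (intro sum.cong) (auto simp: eq ring_distribs)
  moreover have "(\<Sum>w\<in>W. Re (cnj (G w) * (D w * G w))) \<le> M * V"
  proof -
    have "Re (cnj (G w) * (D w * G w)) = Re (D w) * (cmod (G w))\<^sup>2" for w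
      by (simp add: cmod_power2) algebra
    then show ?thesis unfolding V_def sum_distrib_left using M
      by (auto intro!: sum_mono mult_right_mono)
  qed
  moreover have "(\<Sum>w\<in>W. Re (cnj (G w) * A1 G w)) \<ge> \<rho> * V"
  proof -
    have "\<rho> * V = (\<Sum>w\<in>W. (\<Sum>a\<in>A. Re (k a) * s a w / t) * (cmod (G w))\<^sup>2)"
      unfolding V_def sum_distrib_left using \<rho> by (intro sum.cong) auto
    also have "\<dots> = (\<Sum>w\<in>W. \<Sum>a\<in>A. Re (k a / of_real t) * s a w * (cmod (G w))\<^sup>2)"
      unfolding sum_distrib_right by (simp add: Re_divide_of_real)
    also have "\<dots> = (\<Sum>a\<in>A. \<Sum>w\<in>W. Re (k a / of_real t) * s a w * (cmod (G w))\<^sup>2)"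
      by (rule sum.swap)
    also have "\<dots> \<le> (\<Sum>a\<in>A. Re (\<Sum>w\<in>W. cnj (G w) * (k a / of_real t * (G w - of_real (1 - s a w) * G (\<tau> a w)))))"
      by (intro sum_mono involution_dissipative) (use \<tau> s k t in \<open>auto simp: Re_divide_of_real\<close>)
    also have "\<dots> = (\<Sum>w\<in>W. Re (cnj (G w) * A1 G w))"
      unfolding A1_def sum_distrib_left Re_sum by (rule sum.swap)
    finally show ?thesis .
  qed
  moreover have "(\<Sum>w\<in>W. Re (cnj (G w) * err w)) \<le> (\<Sum>w\<in>W. (4 * \<kappa> + 1) * \<beta> * (2 * V))"
  proof (intro sum_mono)
    fix w assume w: "w \<in> W"
    have "(cmod (G w))\<^sup>2 \<le> V" unfolding V_def
      by (rule member_le_sum[where f = "\<lambda>w. (cmod (G w))\<^sup>2"]) (use w fin in auto)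
    then have Gw: "cmod (G w) \<le> sqrt V" using real_le_rsqrt by blast
    have "Re (cnj (G w) * err w) \<le> cmod (G w) * cmod (err w)"
      using complex_Re_le_cmod[of "cnj (G w) * err w"] by (simp add: norm_mult)
    also have "\<dots> \<le> sqrt V * ((4 * \<kappa> + 1) * \<beta> * m)"
      using Gw err[OF w] V0 by (intro mult_mono) auto
    also have "\<dots> = (4 * \<kappa> + 1) * \<beta> * (2 * V)" using V0 by (simp add: m_def)
    finally show "Re (cnj (G w) * err w) \<le> (4 * \<kappa> + 1) * \<beta> * (2 * V)" .
  qed
  ultimately have "(\<Sum>w\<in>W. Re (cnj (G w) * (dF w + (\<Sum>a\<in>A. b' a w * F (\<tau> a w) + b a w * dF (\<tau> a w)))))
      \<le> (M - \<rho> + 2 * card W * (4 * \<kappa> + 1) * \<beta>) * V"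
    by (simp add: algebra_simps)
  from mult_left_mono[OF this, of 2] show ?thesis
    unfolding sum_distrib_left[symmetric] V_def[symmetric] \<kappa>_def[symmetric] by (simp only: mult.assoc)
qed

section \<open>A uniform bound at the end of the ray for the singular system\<close>

text \<open>Independent of \<open>u\<close>, \<open>v\<close> and \<open>D\<close>, hence uniform in
  the point at which the kernel is evaluated. The prefactor comes from the initial energy
  \<open>card W\<close> and the inversion of the gauge, the logarithms from comparing
  \<open>K^2 + v^2\<close> with \<open>(1 + v)^2\<close>, and the term with \<open>pi / 2\<close>
  from the total mass of the error.\<close>

definition reflection_ode_const :: "'w set \<Rightarrow> 'r set \<Rightarrow> ('r \<Rightarrow> complex) \<Rightarrow> ('r \<Rightarrow> complex) \<Rightarrow> real" where
  "reflection_ode_const W A k c =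
     (let L = (\<Sum>a\<in>A. cmod (k a / c a)); K = 1 + L in
      2 * sqrt (card W) * exp ((\<Sum>a\<in>A. Re (k a) * ln (2 * K\<^sup>2) / 2)
        + 2 * card W * (4 * (\<Sum>a\<in>A. cmod (k a)) + 1) * L * (card A * card W * (pi / 2 / K))))"

text \<open>The weight \<open>t / (K\<^sup>2 + t\<^sup>2 \<bar>u\<bar>\<^sup>2)\<close> in \<open>b\<close> vanishes at \<open>t = 0\<close>,
  where the coupling is singular, and makes all error terms integrable with an \<open>arctan\<close> as
  primitive; the uncoupled rest \<open>s / t\<close> of the coupling integrates to a logarithm, which is
  the factor \<open>(1 + v)\<close> to the power \<open>- Re k\<close>.\<close>

lemma reflection_ode_bound:
  fixes F :: "'w \<Rightarrow> real \<Rightarrow> complex" and W :: "'w set" and A :: "'r set" and \<tau> :: "'r \<Rightarrow> 'w \<Rightarrow> 'w"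
    and k c :: "'r \<Rightarrow> complex" and u :: "'r \<Rightarrow> 'w \<Rightarrow> complex" and v :: "'r \<Rightarrow> real"
  assumes fin: "finite W" "finite A"
    and \<tau>: "\<And>a w. a \<in> A \<Longrightarrow> w \<in> W \<Longrightarrow> \<tau> a w \<in> W \<and> \<tau> a (\<tau> a w) = w"
    and u: "\<And>a w. a \<in> A \<Longrightarrow> w \<in> W \<Longrightarrow> u a (\<tau> a w) = - u a w"
    and D: "\<And>a w. a \<in> A \<Longrightarrow> w \<in> W \<Longrightarrow> D w - D (\<tau> a w) = c a * u a w"
    and k: "\<And>a. a \<in> A \<Longrightarrow> Re (k a) \<ge> 0" and c: "\<And>a. a \<in> A \<Longrightarrow> c a \<noteq> 0"
    and M: "\<And>w. w \<in> W \<Longrightarrow> Re (D w) \<le> M"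
    and F0: "\<And>w. w \<in> W \<Longrightarrow> F w 0 = 1"
    and cont: "\<And>w. w \<in> W \<Longrightarrow> continuous_on {0..1} (F w)"
    and ode: "\<And>w t. w \<in> W \<Longrightarrow> 0 < t \<Longrightarrow> t < 1 \<Longrightarrow> (F w has_vector_derivative
        (D w * F w t - (\<Sum>a\<in>A. k a * (F w t - F (\<tau> a w) t) / of_real t))) (at t)"
    and v: "\<And>a. a \<in> A \<Longrightarrow> v a \<ge> 0"
    and inv: "\<And>h w. w \<in> W \<Longrightarrow> (\<Sum>a\<in>A. Re (k a) * h (cmod (u a w))) = (\<Sum>a\<in>A. Re (k a) * h (v a))"
    and w: "w \<in> W"
  shows "cmod (F w 1) \<le> reflection_ode_const W A k c * exp (M - (\<Sum>a\<in>A. Re (k a) * ln (1 + v a)))"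
proof -
  define L where "L = (\<Sum>a\<in>A. cmod (k a / c a))"
  \<comment> \<open>Makes the gauge small: the sum of all \<open>cmod (b a w t)\<close> is at most
    \<open>L / (2 * K)\<close>, hence at most 1/2.\<close>
  define K where "K = 1 + L"
  define \<kappa> where "\<kappa> = (\<Sum>a\<in>A. cmod (k a))"
  define C1 where "C1 = 2 * card W * (4 * \<kappa> + 1)"
  define q where "q = (\<lambda>a w t. K\<^sup>2 + t\<^sup>2 * (cmod (u a w))\<^sup>2)"
  \<comment> \<open>Solves \<open>b * c * u = k * s / t\<close>. The factor \<open>cnj u / q\<close>
    replaces the singular \<open>1 / u\<close>, so \<open>b\<close> stays bounded where
    \<open>u\<close> vanishes; dividing by \<open>c\<close> is where regularity enters.\<close>
  define b where "b = (\<lambda>a w t. k a / c a * (of_real (t / q a w t) * cnj (u a w)))"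
  define b' where "b' = (\<lambda>a w t. k a / c a * (of_real ((K\<^sup>2 - t\<^sup>2 * (cmod (u a w))\<^sup>2) / (q a w t)\<^sup>2) * cnj (u a w)))"
  define s where "s = (\<lambda>a w t. t\<^sup>2 * (cmod (u a w))\<^sup>2 / q a w t)"
  \<comment> \<open>Summing over all indices gives one error density that dominates every single
    \<open>cmod (u a w) / q a w t\<close>.\<close>
  define \<eta> where "\<eta> = (\<lambda>t. \<Sum>a\<in>A. \<Sum>w\<in>W. cmod (u a w) / q a w t)"
  define \<rho> where "\<rho> = (\<lambda>t. \<Sum>a\<in>A. Re (k a) * (t * (v a)\<^sup>2 / (K\<^sup>2 + t\<^sup>2 * (v a)\<^sup>2)))"
  define G where "G = (\<lambda>w t. F w t + (\<Sum>a\<in>A. b a w t * F (\<tau> a w) t))"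
  define V where "V = (\<lambda>t. \<Sum>w\<in>W. (cmod (G w t))\<^sup>2)"
  define dF where "dF = (\<lambda>w t. D w * F w t - (\<Sum>a\<in>A. k a * (F w t - F (\<tau> a w) t) / of_real t))"
  define dG where "dG = (\<lambda>w t. dF w t + (\<Sum>a\<in>A. b' a w t * F (\<tau> a w) t + b a w t * dF (\<tau> a w) t))"
  define P where "P = (\<lambda>t. 2 * (M * t - (\<Sum>a\<in>A. Re (k a) * (ln (K\<^sup>2 + t\<^sup>2 * (v a)\<^sup>2) / 2))
      + C1 * (L * (\<Sum>a\<in>A. \<Sum>w\<in>W. arctan (t * cmod (u a w) / K) / K))))"
  have L0: "L \<ge> 0" unfolding L_def by (intro sum_nonneg) auto
  then have K1: "K \<ge> 1" "K > 0" by (auto simp: K_def)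
  have \<kappa>0: "\<kappa> \<ge> 0" unfolding \<kappa>_def by (intro sum_nonneg) auto
  have C1: "C1 \<ge> 0" using \<kappa>0 by (simp add: C1_def)
  have q0: "q a w t > 0" for a w t
    using K1 by (auto simp: q_def intro!: add_pos_nonneg)
  have v0: "K\<^sup>2 + t\<^sup>2 * (v a)\<^sup>2 > 0" for a t
    using K1 by (auto intro!: add_pos_nonneg)
  have summand_le: "cmod (u a w) / q a w t \<le> \<eta> t" if "a \<in> A" "w \<in> W" for a w t
  proof -
    have nn: "cmod (u a w) / q a w t \<ge> 0" for a w using q0[of a w t] by simp
    have "cmod (u a w) / q a w t \<le> (\<Sum>w\<in>W. cmod (u a w) / q a w t)"
      by (rule member_le_sum[where f = "\<lambda>w. cmod (u a w) / q a w t"]) (use that fin nn in auto)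
    also have "\<dots> \<le> \<eta> t" unfolding \<eta>_def
      by (rule member_le_sum[where f = "\<lambda>a. \<Sum>w\<in>W. cmod (u a w) / q a w t"])
         (use that fin nn in \<open>auto intro: sum_nonneg\<close>)
    finally show ?thesis .
  qed
  have b_le: "cmod (b a w t) \<le> cmod (k a / c a) * (t * \<eta> t)" if "a \<in> A" "w \<in> W" "t \<ge> 0" for a w t
  proof -
    have "cmod (b a w t) = cmod (k a / c a) * (t * (cmod (u a w) / q a w t))"
      using that q0[of a w t] by (simp add: b_def norm_mult norm_divide)
    also have "\<dots> \<le> cmod (k a / c a) * (t * \<eta> t)"
      using summand_le that by (intro mult_left_mono) auto
    finally show ?thesis .
  qed
  have b_half: "cmod (b a w t) \<le> cmod (k a / c a) * (1 / (2 * K))" if "a \<in> A" "w \<in> W" "t \<ge> 0" for a w t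
  proof -
    have "cmod (b a w t) = cmod (k a / c a) * (t * cmod (u a w) / q a w t)"
      using that q0[of a w t] by (simp add: b_def norm_mult norm_divide)
    \<comment> \<open>The arithmetic-geometric mean inequality for \<open>K\<close> and
      \<open>t * cmod (u a w)\<close>.\<close>
    also have "t * cmod (u a w) / q a w t \<le> 1 / (2 * K)"
      using sum_squares_bound[of K "t * cmod (u a w)"] q0[of a w t] K1
      by (simp add: q_def field_simps power_mult_distrib power2_eq_square)
    finally show ?thesis by (simp add: mult_left_mono)
  qed
  have b'_le: "cmod (b' a w t) \<le> cmod (k a / c a) * \<eta> t" if "a \<in> A" "w \<in> W" for a w t
  proof -
    have "\<bar>K\<^sup>2 - t\<^sup>2 * (cmod (u a w))\<^sup>2\<bar> \<le> q a w t" by (simp add: q_def abs_le_iff)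
    then have "\<bar>K\<^sup>2 - t\<^sup>2 * (cmod (u a w))\<^sup>2\<bar> / (q a w t)\<^sup>2 \<le> q a w t / (q a w t)\<^sup>2"
      by (intro divide_right_mono) auto
    also have "\<dots> = 1 / q a w t" using q0[of a w t] by (simp add: power2_eq_square)
    finally have "\<bar>K\<^sup>2 - t\<^sup>2 * (cmod (u a w))\<^sup>2\<bar> / (q a w t)\<^sup>2 * cmod (u a w) \<le> 1 / q a w t * cmod (u a w)"
      by (rule mult_right_mono) auto
    also have "\<dots> \<le> \<eta> t" using summand_le[OF that, of t] by simp
    finally have "cmod (k a / c a) * (\<bar>K\<^sup>2 - t\<^sup>2 * (cmod (u a w))\<^sup>2\<bar> / (q a w t)\<^sup>2 * cmod (u a w))
        \<le> cmod (k a / c a) * \<eta> t" by (rule mult_left_mono) auto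
    moreover have "cmod (of_real ((K\<^sup>2 - t\<^sup>2 * (cmod (u a w))\<^sup>2) / (q a w t)\<^sup>2) :: complex)
        = \<bar>K\<^sup>2 - t\<^sup>2 * (cmod (u a w))\<^sup>2\<bar> / (q a w t)\<^sup>2"
      unfolding norm_of_real by simp
    ultimately show ?thesis unfolding b'_def norm_mult by simp
  qed
  have half: "(\<Sum>a\<in>A. cmod (b a w t)) \<le> 1 / 2" if "w \<in> W" "t \<ge> 0" for w t
  proof -
    have "(\<Sum>a\<in>A. cmod (b a w t)) \<le> (\<Sum>a\<in>A. cmod (k a / c a) * (1 / (2 * K)))"
      using b_half that by (intro sum_mono) auto
    also have "\<dots> = L / (2 * K)" unfolding L_def sum_distrib_right[symmetric] by simp
    also have "\<dots> \<le> 1 / 2" using L0 by (simp add: K_def field_simps)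
    finally show ?thesis .
  qed
  have Gderiv: "(G w has_vector_derivative dG w t) (at t)" if "w \<in> W" "0 < t" "t < 1" for w t
  proof -
    have "((\<lambda>t. t / q a w t) has_real_derivative (K\<^sup>2 - t\<^sup>2 * (cmod (u a w))\<^sup>2) / (q a w t)\<^sup>2) (at t)" for a
      using q0[of a w t] unfolding q_def
      by (auto intro!: derivative_eq_intros simp: power2_eq_square divide_simps)
    then have "((\<lambda>t. b a w t) has_vector_derivative b' a w t) (at t)" for a
      unfolding b_def b'_def
      by (intro has_vector_derivative_mult_right has_vector_derivative_mult_left has_vector_derivative_of_real)
         (simp add: has_real_derivative_iff_has_vector_derivative)
    moreover have "(F w has_vector_derivative dF w t) (at t)" if "w \<in> W" for w
      using ode[OF that \<open>0 < t\<close> \<open>t < 1\<close>] by (simp add: dF_def)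
    ultimately show ?thesis using that \<tau> unfolding G_def dG_def
      by (intro has_vector_derivative_add has_vector_derivative_sum)
         (auto intro!: has_vector_derivative_mult[THEN has_vector_derivative_eq_rhs])
  qed
  have Vderiv: "(V has_real_derivative (\<Sum>w\<in>W. 2 * Re (cnj (G w t) * dG w t))) (at t)"
    if "0 < t" "t < 1" for t
  proof -
    have "((\<lambda>t. (cmod (G w t))\<^sup>2) has_real_derivative 2 * Re (cnj (G w t) * dG w t)) (at t)"
      if "w \<in> W" for w
    proof -
      note d = Gderiv[OF that \<open>0 < t\<close> \<open>t < 1\<close>]
      show ?thesis unfolding cmod_power2
        by (auto intro!: derivative_eq_intros d)
    qed
    then show ?thesis unfolding V_def by (rule DERIV_sum)
  qed
  have "V 1 \<le> V 0 * exp (P 1 - P 0)"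
  proof (rule gronwall_open[of 0 1 V P _ "\<lambda>t. 2 * (M - \<rho> t + C1 * (L * \<eta> t))"])
    have "continuous_on {0..1} (\<lambda>t. b a w t)" for a w
      unfolding b_def q_def using q0[unfolded q_def]
      by (intro continuous_intros) (auto simp: less_imp_neq[THEN not_sym])
    then have "continuous_on {0..1} (G w)" if "w \<in> W" for w
      unfolding G_def using that cont \<tau> by (intro continuous_intros) auto
    then show "continuous_on {0..1} V" unfolding V_def by (intro continuous_intros) auto
    show "continuous_on {0..1} P"
      unfolding P_def using v0 K1 by (intro continuous_intros) (auto simp: less_imp_neq[THEN not_sym])
    fix t :: real assume t: "0 < t" "t < 1"
    show "(V has_real_derivative (\<Sum>w\<in>W. 2 * Re (cnj (G w t) * dG w t))) (at t)" by (rule Vderiv[OF t])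
    have lnd: "((\<lambda>t. Re (k a) * (ln (K\<^sup>2 + t\<^sup>2 * (v a)\<^sup>2) / 2)) has_real_derivative
        Re (k a) * (t * (v a)\<^sup>2 / (K\<^sup>2 + t\<^sup>2 * (v a)\<^sup>2))) (at t)" for a
      using v0[of t a] by (auto intro!: derivative_eq_intros simp: field_simps)
    have atd: "((\<lambda>t. arctan (t * cmod (u a w) / K) / K) has_real_derivative cmod (u a w) / q a w t) (at t)" for a w
    proof -
      have "1 + (t * cmod (u a w) / K)\<^sup>2 = q a w t / K\<^sup>2"
        using K1 by (simp add: q_def field_simps power_mult_distrib)
      then show ?thesis using K1 q0[of a w t]
        by (auto intro!: derivative_eq_intros simp: field_simps power2_eq_square)
    qed
    show "(P has_real_derivative 2 * (M - \<rho> t + C1 * (L * \<eta> t))) (at t)"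
      unfolding P_def \<rho>_def \<eta>_def
      by (intro DERIV_cmult DERIV_add DERIV_diff DERIV_sum lnd atd) (auto intro!: derivative_eq_intros)
    have "(\<Sum>w\<in>W. 2 * Re (cnj (G w t) * dG w t))
       \<le> 2 * (M - \<rho> t + 2 * card W * (4 * (\<Sum>a\<in>A. cmod (k a)) + 1) * (L * \<eta> t)) * V t"
      unfolding G_def dG_def V_def
    proof (rule gauged_energy_derivative[where s = "\<lambda>a w. s a w t" and D = D and t = t])
      show "s a (\<tau> a w) t = s a w t \<and> 0 \<le> s a w t \<and> s a w t \<le> 1" if "a \<in> A" "w \<in> W" for a w
        using u[OF that] q0[of a w t] by (auto simp: s_def q_def)
      show "b a w t * (D w - D (\<tau> a w)) = k a * of_real (s a w t) / of_real t" if "a \<in> A" "w \<in> W" for a w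
      proof -
        have "b a w t * (D w - D (\<tau> a w)) = k a * (of_real (t / q a w t) * (u a w * cnj (u a w)))"
          using c[OF that(1)] by (simp add: D[OF that] b_def field_simps)
        also have "\<dots> = k a * of_real (s a w t) / of_real t"
          using t by (simp add: complex_norm_square[symmetric] s_def power2_eq_square flip: of_real_power)
        finally show ?thesis .
      qed
      \<comment> \<open>The invariance hypothesis, applied to this profile of
        \<open>cmod (u a w)\<close>, makes the decay rate the same for all \<open>w\<close>, as the
        energy estimate demands.\<close>
      show "(\<Sum>a\<in>A. Re (k a) * s a w t / t) = \<rho> t" if "w \<in> W" for w
        using inv[OF that, of "\<lambda>x. t * x\<^sup>2 / (K\<^sup>2 + t\<^sup>2 * x\<^sup>2)"] t
        by (simp add: s_def q_def \<rho>_def power2_eq_square mult.assoc)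
      show "(\<Sum>a\<in>A. cmod (b a w t)) \<le> t * (L * \<eta> t)" if "w \<in> W" for w
      proof -
        have "(\<Sum>a\<in>A. cmod (b a w t)) \<le> (\<Sum>a\<in>A. cmod (k a / c a) * (t * \<eta> t))"
          using b_le that t by (intro sum_mono) auto
        also have "\<dots> = t * (L * \<eta> t)" unfolding sum_distrib_right[symmetric] L_def by simp
        finally show ?thesis .
      qed
      show "(\<Sum>a\<in>A. cmod (b' a w t)) \<le> L * \<eta> t" if "w \<in> W" for w
        unfolding L_def sum_distrib_right using b'_le that by (intro sum_mono) auto
    qed (use fin \<tau> k t M half in \<open>auto simp: dF_def\<close>)
    then show "(\<Sum>w\<in>W. 2 * Re (cnj (G w t) * dG w t)) \<le> 2 * (M - \<rho> t + C1 * (L * \<eta> t)) * V t"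
      by (simp add: C1_def \<kappa>_def)
  qed simp
  \<comment> \<open>The gauge is trivial at \<open>t = 0\<close>, because \<open>b\<close> carries
    the factor \<open>t\<close>.\<close>
  moreover have "V 0 = card W" using F0 by (simp add: V_def G_def b_def)
  moreover have "P 1 - P 0 \<le> 2 * (M - (\<Sum>a\<in>A. Re (k a) * ln (1 + v a)) + (\<Sum>a\<in>A. Re (k a) * ln (2 * K\<^sup>2) / 2)
      + C1 * L * (card A * card W * (pi / 2 / K)))"
  proof -
    \<comment> \<open>Since \<open>K\<close> \<ge> 1, \<open>(1 + v)^2\<close> \<le>
      \<open>2 * (K^2 + v^2)\<close>. Multiplying by \<open>K^2\<close> before taking logarithms
      accounts for the value of \<open>P\<close> at 0.\<close>
    have "ln (1 + v a) - ln (2 * K\<^sup>2) / 2 \<le> ln (K\<^sup>2 + (v a)\<^sup>2) / 2 - ln (K\<^sup>2) / 2" if a: "a \<in> A" for a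
    proof -
      have "(1 + v a)\<^sup>2 \<le> 2 * (K\<^sup>2 + (v a)\<^sup>2)"
        using sum_squares_bound[of 1 "v a"] one_le_power[OF K1(1), of 2] by (simp add: power2_sum)
      then have "(1 + v a)\<^sup>2 * K\<^sup>2 \<le> (2 * (K\<^sup>2 + (v a)\<^sup>2)) * K\<^sup>2" by (rule mult_right_mono) auto
      also have "\<dots> = (K\<^sup>2 + (v a)\<^sup>2) * (2 * K\<^sup>2)" by (simp only: mult_ac)
      finally have "ln ((1 + v a)\<^sup>2 * K\<^sup>2) \<le> ln ((K\<^sup>2 + (v a)\<^sup>2) * (2 * K\<^sup>2))"
        using v[OF a] K1 by (intro ln_mono) auto
      moreover have "ln ((1 + v a)\<^sup>2 * K\<^sup>2) = 2 * ln (1 + v a) + ln (K\<^sup>2)"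
        using v[OF a] K1 by (simp add: ln_mult ln_realpow)
      moreover have "ln ((K\<^sup>2 + (v a)\<^sup>2) * (2 * K\<^sup>2)) = ln (K\<^sup>2 + (v a)\<^sup>2) + ln (2 * K\<^sup>2)"
        using K1 v0[of 1 a] by (intro ln_mult_pos) auto
      ultimately show ?thesis by simp
    qed
    then have "(\<Sum>a\<in>A. Re (k a) * (ln (1 + v a) - ln (2 * K\<^sup>2) / 2))
        \<le> (\<Sum>a\<in>A. Re (k a) * (ln (K\<^sup>2 + (v a)\<^sup>2) / 2 - ln (K\<^sup>2) / 2))"
      using k by (intro sum_mono mult_left_mono) auto
    then have 1: "(\<Sum>a\<in>A. Re (k a) * ln (1 + v a)) - (\<Sum>a\<in>A. Re (k a) * ln (2 * K\<^sup>2) / 2)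
      \<le> (\<Sum>a\<in>A. Re (k a) * (ln (K\<^sup>2 + (v a)\<^sup>2) / 2)) - (\<Sum>a\<in>A. Re (k a) * (ln (K\<^sup>2) / 2))"
      by (simp add: sum_subtractf[symmetric] right_diff_distrib)
    have "(\<Sum>a\<in>A. \<Sum>w\<in>W. arctan (1 * cmod (u a w) / K) / K) \<le> (\<Sum>a\<in>A. \<Sum>w\<in>W. pi / 2 / K)"
      using K1 arctan_ubound by (intro sum_mono divide_right_mono) (auto intro: less_imp_le)
    then have "C1 * (L * (\<Sum>a\<in>A. \<Sum>w\<in>W. arctan (1 * cmod (u a w) / K) / K)) \<le> C1 * (L * (card A * card W * (pi / 2 / K)))"
      using C1 L0 by (intro mult_left_mono) auto
    with 1 show ?thesis unfolding P_def by (simp add: algebra_simps)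
  qed
  ultimately have V1: "V 1 \<le> card W * exp (2 * (M - (\<Sum>a\<in>A. Re (k a) * ln (1 + v a)) + (\<Sum>a\<in>A. Re (k a) * ln (2 * K\<^sup>2) / 2)
      + C1 * L * (card A * card W * (pi / 2 / K))))" (is "_ \<le> card W * exp (2 * ?e)")
    by (smt (verit, best) exp_le_cancel_iff mult_left_mono of_nat_0_le_iff)
  have "(cmod (F w 1))\<^sup>2 \<le> 4 * V 1" unfolding V_def G_def
    by (rule perturbed_identity_bound) (use fin \<tau> half w in auto)
  also have "\<dots> \<le> (2 * sqrt (card W) * exp ?e)\<^sup>2"
    using V1 unfolding exp_double by (simp add: power_mult_distrib)
  finally have "cmod (F w 1) \<le> 2 * sqrt (card W) * exp ?e" by (rule power2_le_imp_le) simp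
  also have "?e = ((\<Sum>a\<in>A. Re (k a) * ln (2 * K\<^sup>2) / 2) + C1 * L * (card A * card W * (pi / 2 / K)))
      + (M - (\<Sum>a\<in>A. Re (k a) * ln (1 + v a)))" by simp
  also have "2 * sqrt (card W) * exp \<dots> = reflection_ode_const W A k c * exp (M - (\<Sum>a\<in>A. Re (k a) * ln (1 + v a)))"
    unfolding exp_add reflection_ode_const_def Let_def L_def[symmetric] K_def[symmetric] C1_def \<kappa>_def by simp
  finally show ?thesis .
qed

section \<open>Reflection groups\<close>

lemma linear_reflection: "linear (reflection \<alpha>)"
  by (rule linearI) (auto simp: reflection_def algebra_simps)

lemma reflection_reflection:
  assumes "\<alpha> \<bullet> \<alpha> = 2" shows "reflection \<alpha> (reflection \<alpha> x) = x"
  using assms by (simp add: reflection_def inner_diff_right algebra_simps flip: scaleR_add_left)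

lemma reflection_inner:
  assumes "\<alpha> \<bullet> \<alpha> = 2" shows "reflection \<alpha> x \<bullet> reflection \<alpha> y = x \<bullet> y"
  using assms by (simp add: reflection_def inner_diff_right inner_diff_left inner_commute algebra_simps)

lemma reflection_self:
  assumes "\<alpha> \<bullet> \<alpha> = 2" shows "reflection \<alpha> \<alpha> = - \<alpha>"
  using assms by (simp add: reflection_def algebra_simps scaleR_2)

context
  fixes R :: "'a::euclidean_space set"
  assumes R: "root_system R"
begin

lemma root_inner_self: "\<alpha> \<in> R \<Longrightarrow> \<alpha> \<bullet> \<alpha> = 2"
  and finite_roots: "finite R"
  and reflection_image_roots: "\<alpha> \<in> R \<Longrightarrow> reflection \<alpha> ` R = R"
  and span_roots: "span R = UNIV"
  using R by (auto simp: root_system_def)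

lemma uminus_root: "\<alpha> \<in> R \<Longrightarrow> - \<alpha> \<in> R"
  using reflection_image_roots reflection_self root_inner_self by (metis imageI)

lemma reflection_group_linear: "w \<in> reflection_group R \<Longrightarrow> linear w"
  by (induction rule: reflection_group.induct)
    (auto intro: linear_compose[OF _ linear_reflection] simp: id_def linear_ident simp del: o_apply)

lemma reflection_group_inner: "w \<in> reflection_group R \<Longrightarrow> w x \<bullet> w y = x \<bullet> y"
  by (induction rule: reflection_group.induct) (auto simp: reflection_inner root_inner_self)

lemma reflection_group_image_roots: "w \<in> reflection_group R \<Longrightarrow> w ` R = R"
proof (induction rule: reflection_group.induct)
  case (comp \<alpha> w)
  then show ?case using reflection_image_roots by (metis image_comp)
qed simp

text \<open>The inductive definition only prepends reflections; inverting a word reverses it and so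
  requires appending them.\<close>

lemma reflection_group_comp_reflection:
  assumes "\<alpha> \<in> R" "w \<in> reflection_group R" shows "w \<circ> reflection \<alpha> \<in> reflection_group R"
  using assms(2)
proof (induction rule: reflection_group.induct)
  case id
  then show ?case using reflection_group.comp[OF assms(1) reflection_group.id] by simp
next
  case (comp \<beta> w)
  then show ?case by (simp only: comp_assoc reflection_group.comp)
qed

lemma reflection_group_inverse:
  assumes "w \<in> reflection_group R"
  shows "\<exists>v\<in>reflection_group R. w \<circ> v = id"
  using assms
proof (induction rule: reflection_group.induct)
  case id
  then show ?case by (intro bexI[of _ id] reflection_group.id) simp
next
  case (comp \<alpha> w)
  then obtain v where v: "v \<in> reflection_group R" "w \<circ> v = id" by blast
  have "(reflection \<alpha> \<circ> w) \<circ> (v \<circ> reflection \<alpha>) = reflection \<alpha> \<circ> (w \<circ> v) \<circ> reflection \<alpha>"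
    by (simp add: comp_assoc)
  also have "\<dots> = id" using v reflection_reflection[OF root_inner_self[OF comp(1)]] by (auto simp: fun_eq_iff)
  finally show ?case using reflection_group_comp_reflection[OF comp(1) v(1)] by blast
qed

text \<open>A group element is linear and maps the finite spanning set \<open>R\<close> to itself,
  so it is determined by its restriction to \<open>R\<close>.\<close>

lemma finite_reflection_group: "finite (reflection_group R)"
proof (rule inj_on_finite[of "\<lambda>w. restrict w R" _ "R \<rightarrow>\<^sub>E R"])
  show "inj_on (\<lambda>w. restrict w R) (reflection_group R)"
  proof (rule inj_onI)
    fix v w assume *: "v \<in> reflection_group R" "w \<in> reflection_group R" "restrict v R = restrict w R"
    have "v x = w x" for x
    proof (rule linear_eq_on[of v w x R])
      show "v b = w b" if "b \<in> R" for b using *(3) that by (metis restrict_apply')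
    qed (use * reflection_group_linear span_roots in auto)
    then show "v = w" by (simp add: fun_eq_iff)
  qed
  show "(\<lambda>w. restrict w R) ` reflection_group R \<subseteq> R \<rightarrow>\<^sub>E R"
    using reflection_group_image_roots by (fastforce simp: PiE_iff extensional_def)
  show "finite (R \<rightarrow>\<^sub>E R)" by (intro finite_PiE finite_roots)
qed

section \<open>Invariance of sums over positive roots\<close>

text \<open>\<open>R\<close> is the disjoint union of \<open>Rp\<close> and its negatives, and an
  even function contributes equally on both.\<close>

lemma sum_positive_roots:
  fixes h :: "'a \<Rightarrow> real"
  assumes Rp: "positive_roots R Rp" and h: "\<And>\<alpha>. \<alpha> \<in> R \<Longrightarrow> h (- \<alpha>) = h \<alpha>"
  shows "2 * sum h Rp = sum h R"
proof -
  obtain c where c: "c \<in> regular_set R" "Rp = {\<alpha>\<in>R. \<alpha> \<bullet> c > 0}"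
    using Rp by (auto simp: positive_roots_def)
  have "R = Rp \<union> uminus ` Rp"
  proof (intro equalityI subsetI)
    fix \<alpha> assume \<alpha>: "\<alpha> \<in> R"
    then have "\<alpha> \<bullet> c \<noteq> 0" using c by (auto simp: regular_set_def)
    then have "\<alpha> \<in> Rp \<or> - \<alpha> \<in> Rp" using \<alpha> uminus_root c(2) by (auto simp: linorder_neq_iff)
    then show "\<alpha> \<in> Rp \<union> uminus ` Rp" by force
  qed (use c(2) uminus_root in auto)
  moreover have "Rp \<inter> uminus ` Rp = {}" using c(2) by auto
  moreover have "finite Rp" using c(2) finite_roots by auto
  ultimately have "sum h R = sum h Rp + sum h (uminus ` Rp)"
    by (metis finite_imageI sum.union_disjoint)
  also have "sum h (uminus ` Rp) = sum h Rp"
    using h c(2) by (subst sum.reindex) (auto intro!: sum.cong)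
  finally show ?thesis by simp
qed

text \<open>A group element permutes \<open>R\<close> but in general not \<open>Rp\<close>; for even
  functions the sum over \<open>Rp\<close> is half of the sum over \<open>R\<close>.\<close>

lemma sum_positive_roots_invariant:
  fixes h :: "'a \<Rightarrow> real"
  assumes "positive_roots R Rp" and h: "\<And>\<alpha>. \<alpha> \<in> R \<Longrightarrow> h (- \<alpha>) = h \<alpha>"
    and w: "w \<in> reflection_group R"
  shows "(\<Sum>\<alpha>\<in>Rp. h (w \<alpha>)) = sum h Rp"
proof -
  have image: "w ` R = R" by (rule reflection_group_image_roots[OF w])
  have "inj_on w R" using image finite_roots by (simp add: eq_card_imp_inj_on)
  then have "(\<Sum>\<alpha>\<in>R. h (w \<alpha>)) = sum h R" using sum.reindex[of w R h] image by simp
  moreover have "2 * (\<Sum>\<alpha>\<in>Rp. h (w \<alpha>)) = (\<Sum>\<alpha>\<in>R. h (w \<alpha>))"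
  proof (rule sum_positive_roots[OF assms(1)])
    show "h (w (- \<alpha>)) = h (w \<alpha>)" if "\<alpha> \<in> R" for \<alpha>
      using h[of "w \<alpha>"] image that linear_neg[OF reflection_group_linear[OF w], of \<alpha>] by auto
  qed
  ultimately show ?thesis using sum_positive_roots[OF assms(1), of h] h by simp
qed

end

section \<open>The Euler equation on the complexification\<close>

lemma complexify_map_cscale: "linear w \<Longrightarrow> complexify_map w (cscale \<zeta> z) = cscale \<zeta> (complexify_map w z)"
  by (simp add: complexify_map_def cscale_def times_i_def linear_add linear_diff linear_scale linear_neg)

lemma complexify_map_add: "linear w \<Longrightarrow> complexify_map w (z + u) = complexify_map w z + complexify_map w u"
  by (simp add: complexify_map_def linear_add)

lemma complexify_map_real_point: "linear w \<Longrightarrow> complexify_map w (real_point x) = real_point (w x)"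
  by (simp add: complexify_map_def real_point_def linear_0)

lemma complexify_map_comp: "complexify_map (v \<circ> w) z = complexify_map v (complexify_map w z)"
  by (simp add: complexify_map_def)

lemma complexify_map_id [simp]: "complexify_map id z = z"
  by (simp add: complexify_map_def)

lemma cinner_complexify_map:
  assumes "\<And>x y. w x \<bullet> w y = x \<bullet> y"
  shows "cinner (complexify_map w z) (complexify_map w u) = cinner z u"
  using assms by (simp add: cinner_def complexify_map_def)

lemma complexify_map_reflection:
  "z = complexify_map (reflection \<alpha>) z + cscale (cinner (real_point \<alpha>) z) (real_point \<alpha>)"
  by (cases z) (simp add: complexify_map_def reflection_def cscale_def cinner_def real_point_def times_i_def)

text \<open>In the direction \<xi> = \<open>x\<close> the factor \<open>\<alpha> \<bullet> x\<close>
  cancels the denominator of the reflection quotient. On the hyperplane both sides of that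
  cancellation vanish, whatever value the quotient takes there.\<close>

lemma dunkl_euler_real:
  assumes "is_dunkl_kernel Rp k E"
  shows "cdir_deriv (real_point x) (E l) (real_point x) = cinner (real_point x) l * E l (real_point x)
    - (\<Sum>\<alpha>\<in>Rp. k \<alpha> * (E l (real_point x) - E l (real_point (reflection \<alpha> x))))"
proof -
  have E: "entire2 E" and
    eq: "dunkl_op Rp k x (\<lambda>y. E l (real_point y)) x = cinner (real_point x) l * E l (real_point x)"
    using assms unfolding is_dunkl_kernel_def by blast+
  have quotient: "of_real (\<alpha> \<bullet> x) * reflection_quotient \<alpha> (\<lambda>y. E l (real_point y)) x
      = E l (real_point x) - E l (real_point (reflection \<alpha> x))" for \<alpha>
    by (auto simp: reflection_quotient_def reflection_def)
  then show ?thesis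
    using eq unfolding dunkl_op_def dir_deriv_real_point[OF entire2_imp_gateaux_entire[OF E]]
    unfolding mult.assoc quotient by (simp only: eq_diff_eq)
qed

text \<open>The real equation extends along \<open>\<zeta> \<mapsto> a + \<zeta> b\<close> by the identity theorem.\<close>

lemma dunkl_euler:
  assumes "is_dunkl_kernel Rp k E"
  shows "cdir_deriv v (E l) v = cinner v l * E l v
    - (\<Sum>\<alpha>\<in>Rp. k \<alpha> * (E l v - E l (complexify_map (reflection \<alpha>) v)))"
proof -
  have E: "entire2 E" using assms by (simp add: is_dunkl_kernel_def)
  note ge = entire2_imp_gateaux_entire[OF E]
  define a where "a = real_point (fst v)"
  define b where "b = real_point (snd v)"
  define p where "p = (\<lambda>\<zeta>. a + cscale \<zeta> b)"
  \<comment> \<open>The defect of the equation at \<open>p \<zeta>\<close>. Its radial derivative is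
    split by linearity, so that every term is visibly holomorphic in \<zeta>.\<close>
  define H where "H = (\<lambda>\<zeta>. cdir_deriv a (E l) (p \<zeta>) + \<zeta> * cdir_deriv b (E l) (p \<zeta>)
    - (cinner (p \<zeta>) l * E l (p \<zeta>) - (\<Sum>\<alpha>\<in>Rp. k \<alpha> * (E l (p \<zeta>) - E l (complexify_map (reflection \<alpha>) (p \<zeta>))))))"
  have cdir: "cdir_deriv (p \<zeta>) (E l) z = cdir_deriv a (E l) z + \<zeta> * cdir_deriv b (E l) z" for \<zeta> z
    using cdir_deriv_linear[OF E, of 1 a \<zeta> b l z] by (simp add: p_def)
  have refl_p: "complexify_map (reflection \<alpha>) (p \<zeta>)
      = complexify_map (reflection \<alpha>) a + cscale \<zeta> (complexify_map (reflection \<alpha>) b)" for \<alpha> \<zeta>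
    by (simp add: p_def complexify_map_add complexify_map_cscale linear_reflection)
  have hol: "H holomorphic_on UNIV"
    unfolding H_def refl_p unfolding p_def cinner_add_left cinner_cscale_left
    by (intro holomorphic_on_add holomorphic_on_diff holomorphic_on_mult holomorphic_on_sum holomorphic_on_const
        holomorphic_on_ident gateaux_entireD(2)[OF ge] gateaux_entireD(2)[OF gateaux_entire_cdir_deriv[OF ge]])
  have real: "H \<zeta> = 0" if \<zeta>: "\<zeta> \<in> range of_real" for \<zeta>
  proof -
    obtain t where t: "\<zeta> = of_real t" using \<zeta> by blast
    have "p \<zeta> = real_point (fst v + t *\<^sub>R snd v)" by (simp add: t p_def a_def b_def real_point_def)
    then show ?thesis
      unfolding H_def cdir[symmetric]
      by (simp add: dunkl_euler_real[OF assms] complexify_map_real_point linear_reflection)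
  qed
  have lim: "(0 :: complex) islimpt range of_real"
    unfolding islimpt_approachable
  proof (intro allI impI)
    fix e :: real assume "e > 0"
    then show "\<exists>x'\<in>range complex_of_real. x' \<noteq> 0 \<and> dist x' 0 < e"
      by (intro bexI[of _ "of_real (e / 2)"] rangeI) (simp_all add: norm_divide del: of_real_divide)
  qed
  \<comment> \<open>Real parameters give real points, where the equation is known; the parameter
    \<open>\<i>\<close> reaches \<open>v\<close>.\<close>
  have "H \<i> = 0"
    by (rule analytic_continuation[OF hol open_UNIV connected_UNIV subset_UNIV UNIV_I lim real UNIV_I])
  moreover have "p \<i> = v" by (simp add: p_def a_def b_def real_point_def cscale_def times_i_def)
  ultimately show ?thesis unfolding H_def cdir[symmetric] by simp
qed

section \<open>Growth of the Dunkl kernel\<close>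

definition orbit_exponent :: "'a::euclidean_space set \<Rightarrow> 'a complexified \<Rightarrow> 'a complexified \<Rightarrow> real" where
  "orbit_exponent R l z = Max ((\<lambda>w. Re (cinner (complexify_map w l) z)) ` reflection_group R)"

text \<open>Extends the claimed majorant from real points to the complexification, where Cauchy's
  estimate needs it. Only \<open>Re (k \<alpha>)\<close> appears, since it alone determines the
  modulus of a positive base raised to \<open>- k \<alpha>\<close>.\<close>

definition kernel_growth ::
    "'a::euclidean_space set \<Rightarrow> 'a set \<Rightarrow> ('a \<Rightarrow> complex) \<Rightarrow> 'a complexified \<Rightarrow> 'a complexified \<Rightarrow> real" where
  "kernel_growth R Rp k l z =
     exp (orbit_exponent R l z - (\<Sum>\<alpha>\<in>Rp. Re (k \<alpha>) * ln (1 + cmod (cinner (real_point \<alpha>) z))))"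

context
  fixes R Rp :: "'a::euclidean_space set" and k :: "'a \<Rightarrow> complex"
  assumes R: "root_system R" and Rp: "positive_roots R Rp"
    and inv: "invariant_multiplicity R k" and k: "\<forall>\<alpha>\<in>R. Re (k \<alpha>) \<ge> 0"
begin

lemma positive_roots_subset: "Rp \<subseteq> R"
  using Rp by (auto simp: positive_roots_def)

lemma orbit_exponent_ge:
  "w \<in> reflection_group R \<Longrightarrow> Re (cinner (complexify_map w l) z) \<le> orbit_exponent R l z"
  unfolding orbit_exponent_def using finite_reflection_group[OF R] by (intro Max_ge) auto

lemma orbit_exponent_leI:
  "(\<And>w. w \<in> reflection_group R \<Longrightarrow> Re (cinner (complexify_map w l) z) \<le> M) \<Longrightarrow> orbit_exponent R l z \<le> M"
  unfolding orbit_exponent_def using finite_reflection_group[OF R] reflection_group.id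
  by (intro Max.boundedI) auto

lemma dunkl_kernel_bound:
  assumes E: "is_dunkl_kernel Rp k E" and l: "\<And>\<alpha>. \<alpha> \<in> Rp \<Longrightarrow> cinner (real_point \<alpha>) l \<noteq> 0"
  shows "cmod (E l z) \<le> reflection_ode_const (reflection_group R) Rp k (\<lambda>\<alpha>. cinner (real_point \<alpha>) l)
    * kernel_growth R Rp k l z"
proof -
  let ?W = "reflection_group R"
  let ?w = "\<lambda>w. complexify_map w z"
  have ent: "entire2 E" and E0: "E l (real_point 0) = 1"
    using E unfolding is_dunkl_kernel_def by blast+
  note ge = entire2_imp_gateaux_entire[OF ent]
  have RpR: "\<alpha> \<in> Rp \<Longrightarrow> \<alpha> \<in> R" for \<alpha> using positive_roots_subset by blast
  have self: "cinner (real_point \<alpha>) (real_point \<alpha>) = 2" if "\<alpha> \<in> Rp" for \<alpha>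
    using root_inner_self[OF R RpR[OF that]] by (simp add: cinner_def real_point_def complex_eq_iff)
  \<comment> \<open>The system lives on the whole orbit of \<open>z\<close>, as reflections mix its
    points; the bound is read off at time one and the identity element.\<close>
  have "cmod (E l (1 *\<^sub>R ?w id)) \<le> reflection_ode_const ?W Rp k (\<lambda>\<alpha>. cinner (real_point \<alpha>) l)
    * exp (orbit_exponent R l z - (\<Sum>\<alpha>\<in>Rp. Re (k \<alpha>) * ln (1 + cmod (cinner (real_point \<alpha>) z))))"
  proof (rule reflection_ode_bound[where F = "\<lambda>w t. E l (t *\<^sub>R ?w w)" and \<tau> = "\<lambda>\<alpha> w. reflection \<alpha> \<circ> w"
        and D = "\<lambda>w. cinner (?w w) l" and u = "\<lambda>\<alpha> w. cinner (real_point \<alpha>) (?w w)"])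
    show "finite ?W" by (rule finite_reflection_group[OF R])
    show "finite Rp" using finite_subset[OF positive_roots_subset finite_roots[OF R]] .
    show "id \<in> ?W" by (rule reflection_group.id)
    fix \<alpha> assume \<alpha>: "\<alpha> \<in> Rp"
    show "Re (k \<alpha>) \<ge> 0" using k RpR \<alpha> by blast
    show "cinner (real_point \<alpha>) l \<noteq> 0" using l \<alpha> by blast
    show "cmod (cinner (real_point \<alpha>) z) \<ge> 0" by simp
    fix w assume w: "w \<in> ?W"
    have refl: "?w w = ?w (reflection \<alpha> \<circ> w) + cscale (cinner (real_point \<alpha>) (?w w)) (real_point \<alpha>)"
      unfolding complexify_map_comp by (rule complexify_map_reflection)
    show "reflection \<alpha> \<circ> w \<in> ?W \<and> reflection \<alpha> \<circ> (reflection \<alpha> \<circ> w) = w"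
      using reflection_group.comp[OF RpR[OF \<alpha>] w] reflection_reflection[OF root_inner_self[OF R RpR[OF \<alpha>]]]
      by (simp add: fun_eq_iff)
    show "cinner (real_point \<alpha>) (?w (reflection \<alpha> \<circ> w)) = - cinner (real_point \<alpha>) (?w w)"
      using arg_cong[OF refl, of "cinner (real_point \<alpha>)"]
      by (simp add: cinner_add_right cinner_cscale_right self[OF \<alpha>] eq_neg_iff_add_eq_0 add.commute)
    show "cinner (?w w) l - cinner (?w (reflection \<alpha> \<circ> w)) l
        = cinner (real_point \<alpha>) l * cinner (real_point \<alpha>) (?w w)"
      using arg_cong[OF refl, of "\<lambda>z. cinner z l"]
      by (simp add: cinner_add_left cinner_cscale_left)
  next
    fix w assume w: "w \<in> ?W"
    obtain v where v: "v \<in> ?W" "w \<circ> v = id" using reflection_group_inverse[OF R w] by blast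
    \<comment> \<open>Moving \<open>w\<close> across the bilinear form turns it into its inverse
      \<open>v\<close>. This compares the diagonal entries with the maximum over the orbit of
      \<open>l\<close>, and the inner products with the roots \<open>v \<alpha>\<close>.\<close>
    have move: "cinner (?w w) u = cinner z (complexify_map v u)" for u
      using cinner_complexify_map[OF reflection_group_inner[OF R w], of z "complexify_map v u"] v(2)
      by (simp flip: complexify_map_comp)
    show "Re (cinner (?w w) l) \<le> orbit_exponent R l z"
      using orbit_exponent_ge[OF v(1), of l z] by (simp only: move cinner_commute[of z])
    show "E l (0 *\<^sub>R ?w w) = 1" using E0 by (simp add: real_point_def zero_prod_def)
    show "continuous_on {0..1} (\<lambda>t. E l (t *\<^sub>R ?w w))"
      by (rule continuous_on_compose2[OF gateaux_entireD(1)[OF ge, of UNIV]]) (auto intro: continuous_intros)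
    fix h :: "real \<Rightarrow> real"
    have "(\<Sum>\<alpha>\<in>Rp. Re (k \<alpha>) * h (cmod (cinner (real_point \<alpha>) (?w w))))
        = (\<Sum>\<alpha>\<in>Rp. Re (k (v \<alpha>)) * h (cmod (cinner (real_point (v \<alpha>)) z)))"
    proof (rule sum.cong[OF HOL.refl])
      fix \<alpha> assume "\<alpha> \<in> Rp"
      then have "k (v \<alpha>) = k \<alpha>" using inv v RpR by (auto simp: invariant_multiplicity_def)
      moreover have "cinner (real_point \<alpha>) (?w w) = cinner (real_point (v \<alpha>)) z"
        using move[of "real_point \<alpha>"] complexify_map_real_point[OF reflection_group_linear[OF R v(1)]]
        by (simp add: cinner_commute)
      ultimately show "Re (k \<alpha>) * h (cmod (cinner (real_point \<alpha>) (?w w)))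
          = Re (k (v \<alpha>)) * h (cmod (cinner (real_point (v \<alpha>)) z))" by simp
    qed
    \<comment> \<open>The summand is even in the root: the reflection in \<alpha> sends \<alpha> to
      its negative, so \<open>k\<close> agrees on both.\<close>
    also have "\<dots> = (\<Sum>\<alpha>\<in>Rp. Re (k \<alpha>) * h (cmod (cinner (real_point \<alpha>) z)))"
    proof (rule sum_positive_roots_invariant[OF R Rp _ v(1)])
      fix \<alpha> assume \<alpha>: "\<alpha> \<in> R"
      then have "k (reflection \<alpha> \<alpha>) = k \<alpha>"
        using inv reflection_group.comp[OF \<alpha> reflection_group.id] by (auto simp: invariant_multiplicity_def)
      then have "k (- \<alpha>) = k \<alpha>" using reflection_self root_inner_self[OF R \<alpha>] by metis
      moreover have "cinner (real_point (- \<alpha>)) z = - cinner (real_point \<alpha>) z"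
        by (simp add: cinner_def real_point_def complex_eq_iff)
      ultimately show "Re (k (- \<alpha>)) * h (cmod (cinner (real_point (- \<alpha>)) z))
          = Re (k \<alpha>) * h (cmod (cinner (real_point \<alpha>) z))" by simp
    qed
    finally show "(\<Sum>\<alpha>\<in>Rp. Re (k \<alpha>) * h (cmod (cinner (real_point \<alpha>) (?w w))))
        = (\<Sum>\<alpha>\<in>Rp. Re (k \<alpha>) * h (cmod (cinner (real_point \<alpha>) z)))" .
    fix t :: real assume t: "0 < t"
    let ?v = "?w w"
    let ?S = "\<Sum>\<alpha>\<in>Rp. k \<alpha> * (E l (t *\<^sub>R ?v) - E l (t *\<^sub>R ?w (reflection \<alpha> \<circ> w)))"
    have "complexify_map (reflection \<alpha>) (t *\<^sub>R ?v) = t *\<^sub>R ?w (reflection \<alpha> \<circ> w)" for \<alpha>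
      using complexify_map_cscale[OF linear_reflection, of \<alpha> "of_real t" ?v] by (simp add: complexify_map_comp)
    then have "cdir_deriv (t *\<^sub>R ?v) (E l) (t *\<^sub>R ?v) = cinner (t *\<^sub>R ?v) l * E l (t *\<^sub>R ?v) - ?S"
      using dunkl_euler[OF E, of "t *\<^sub>R ?v" l] by simp
    \<comment> \<open>The radial derivative is \<open>t\<close> times the derivative along the ray;
      dividing by \<open>t\<close> makes the reflection term singular at 0 and leaves the diagonal
      entry independent of \<open>t\<close>.\<close>
    moreover have "cdir_deriv (t *\<^sub>R ?v) (E l) (t *\<^sub>R ?v) = of_real t * cdir_deriv ?v (E l) (t *\<^sub>R ?v)"
      using cdir_deriv_linear[OF ent, of "of_real t" ?v 0 0 l "t *\<^sub>R ?v"] by simp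
    moreover have "cinner (t *\<^sub>R ?v) l = of_real t * cinner ?v l"
      using cinner_cscale_left[of "of_real t" ?v l] by simp
    ultimately have eq: "of_real t * cdir_deriv ?v (E l) (t *\<^sub>R ?v)
        = of_real t * cinner ?v l * E l (t *\<^sub>R ?v) - ?S" by (simp only:)
    have "x = c * e - S / r" if "r * x = r * c * e - S" "r \<noteq> 0" for x c e S r :: complex
      using that by (simp add: field_simps)
    from this[OF eq] have "cdir_deriv ?v (E l) (t *\<^sub>R ?v) = cinner ?v l * E l (t *\<^sub>R ?v) - ?S / of_real t"
      using t by simp
    moreover have "((\<lambda>t. E l (t *\<^sub>R ?v)) has_vector_derivative cdir_deriv ?v (E l) (t *\<^sub>R ?v)) (at t)"
      using cdir_deriv_line[OF ge[of l], of 0 ?v "of_real t", THEN has_vector_derivative_real_field] by simp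
    ultimately show "((\<lambda>t. E l (t *\<^sub>R ?v)) has_vector_derivative cinner ?v l * E l (t *\<^sub>R ?v)
        - (\<Sum>\<alpha>\<in>Rp. k \<alpha> * (E l (t *\<^sub>R ?v) - E l (t *\<^sub>R ?w (reflection \<alpha> \<circ> w))) / of_real t)) (at t)"
      by (simp add: sum_divide_distrib)
  qed
  then show ?thesis by (simp add: kernel_growth_def)
qed

section \<open>From the kernel to its derivatives\<close>

text \<open>A shift by \<open>cscale s h\<close> with \<open>cmod s = 1\<close> changes each
  exponent by at most the modulus of its pairing with \<open>h\<close>. The logarithms obey
  \<open>1 + x + y\<close> \<le> \<open>(1 + x) * (1 + y)\<close>. Neither change depends on
  \<open>z\<close>.\<close>

lemma kernel_growth_slowly_varying:
  "\<exists>C\<ge>0. \<forall>z s. cmod s = 1 \<longrightarrow> kernel_growth R Rp k l (z + cscale s h) \<le> C * kernel_growth R Rp k l z"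
proof -
  define C where "C = (\<Sum>w\<in>reflection_group R. cmod (cinner (complexify_map w l) h))
    + (\<Sum>\<alpha>\<in>Rp. Re (k \<alpha>) * ln (1 + cmod (cinner (real_point \<alpha>) h)))"
  have "kernel_growth R Rp k l (z + cscale s h) \<le> exp C * kernel_growth R Rp k l z" if s: "cmod s = 1" for z s
  proof -
    have "orbit_exponent R l (z + cscale s h)
        \<le> orbit_exponent R l z + (\<Sum>w\<in>reflection_group R. cmod (cinner (complexify_map w l) h))"
    proof (rule orbit_exponent_leI)
      fix w assume w: "w \<in> reflection_group R"
      have "Re (s * cinner (complexify_map w l) h) \<le> cmod (cinner (complexify_map w l) h)"
        using complex_Re_le_cmod[of "s * cinner (complexify_map w l) h"] s by (simp add: norm_mult)
      also have "\<dots> \<le> (\<Sum>w\<in>reflection_group R. cmod (cinner (complexify_map w l) h))"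
        by (rule member_le_sum[where f = "\<lambda>w. cmod (cinner (complexify_map w l) h)"])
           (use w finite_reflection_group[OF R] in auto)
      finally show "Re (cinner (complexify_map w l) (z + cscale s h))
          \<le> orbit_exponent R l z + (\<Sum>w\<in>reflection_group R. cmod (cinner (complexify_map w l) h))"
        unfolding cinner_add_right cinner_cscale_right plus_complex.sel
        using orbit_exponent_ge[OF w, of l z] by linarith
    qed
    moreover have "(\<Sum>\<alpha>\<in>Rp. Re (k \<alpha>) * ln (1 + cmod (cinner (real_point \<alpha>) z)))
       \<le> (\<Sum>\<alpha>\<in>Rp. Re (k \<alpha>) * ln (1 + cmod (cinner (real_point \<alpha>) (z + cscale s h))))
         + (\<Sum>\<alpha>\<in>Rp. Re (k \<alpha>) * ln (1 + cmod (cinner (real_point \<alpha>) h)))"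
      unfolding sum.distrib[symmetric] distrib_left[symmetric]
    proof (intro sum_mono mult_left_mono)
      fix \<alpha> assume "\<alpha> \<in> Rp"
      then show "Re (k \<alpha>) \<ge> 0" using k positive_roots_subset by blast
      let ?x = "cmod (cinner (real_point \<alpha>) (z + cscale s h))" and ?y = "cmod (cinner (real_point \<alpha>) h)"
      have "cmod (cinner (real_point \<alpha>) z) \<le> ?x + ?y"
        using norm_triangle_ineq4[of "cinner (real_point \<alpha>) (z + cscale s h)" "s * cinner (real_point \<alpha>) h"] s
        by (simp add: cinner_add_right cinner_cscale_right norm_mult)
      also have "\<dots> \<le> ?x + ?y + ?x * ?y" by simp
      finally have "1 + cmod (cinner (real_point \<alpha>) z) \<le> (1 + ?x) * (1 + ?y)" by (simp add: algebra_simps)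
      then have "ln (1 + cmod (cinner (real_point \<alpha>) z)) \<le> ln ((1 + ?x) * (1 + ?y))"
        by (intro ln_mono) (auto intro: add_pos_nonneg)
      also have "\<dots> = ln (1 + ?x) + ln (1 + ?y)"
        by (intro ln_mult_pos add_pos_nonneg) auto
      finally show "ln (1 + cmod (cinner (real_point \<alpha>) z)) \<le> ln (1 + ?x) + ln (1 + ?y)" .
    qed
    ultimately show ?thesis unfolding kernel_growth_def exp_add[symmetric] C_def by simp
  qed
  then show ?thesis by (intro exI[of _ "exp C"]) auto
qed

text \<open>The result is again the restriction of an entire function with the same growth on the
  whole complexification. Bounds at real points alone would not carry the induction, as each
  derivative uses complex shifts.\<close>

lemma diff_op_bound:
  assumes "diff_op_of p P" "gateaux_entire g" "\<exists>C\<ge>0. \<forall>z. cmod (g z) \<le> C * kernel_growth R Rp k l z"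
  shows "\<exists>g'. gateaux_entire g' \<and> (\<exists>C\<ge>0. \<forall>z. cmod (g' z) \<le> C * kernel_growth R Rp k l z) \<and>
    P (\<lambda>y. g (real_point y)) = (\<lambda>y. g' (real_point y))"
  using assms
proof (induction arbitrary: g rule: diff_op_of.induct)
  case (const c)
  then obtain C where C: "C \<ge> 0" "\<And>z. cmod (g z) \<le> C * kernel_growth R Rp k l z" by blast
  have "gateaux_entire (\<lambda>z. c * g z)"
    by (rule gateaux_entire_cmult[OF const(1)])
  moreover have "cmod (c * g z) \<le> (cmod c * C) * kernel_growth R Rp k l z" for z
    using mult_left_mono[OF C(2), of "cmod c" z] by (simp add: norm_mult mult.assoc)
  ultimately show ?case
    using C(1) by (intro exI[of _ "\<lambda>z. c * g z"] conjI exI[of _ "cmod c * C"] allI refl) simp_all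
next
  case (linear \<xi>)
  then obtain C where C: "C \<ge> 0" "\<And>z. cmod (g z) \<le> C * kernel_growth R Rp k l z" by blast
  obtain C' where C': "C' \<ge> 0" "\<And>z s. cmod s = 1 \<Longrightarrow>
      kernel_growth R Rp k l (z + cscale s (real_point \<xi>)) \<le> C' * kernel_growth R Rp k l z"
    using kernel_growth_slowly_varying by blast
  have "cmod (cdir_deriv (real_point \<xi>) g z) \<le> (C * C') * kernel_growth R Rp k l z" for z
  proof (rule norm_cdir_deriv_le[OF linear(1)])
    fix s :: complex assume "cmod s = 1"
    then show "cmod (g (z + cscale s (real_point \<xi>))) \<le> C * C' * kernel_growth R Rp k l z"
      using order_trans[OF C(2) mult_left_mono[OF C'(2) C(1)]] by (simp add: mult.assoc)
  qed
  then show ?case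
    by (intro exI[of _ "cdir_deriv (real_point \<xi>) g"] conjI exI[of _ "C * C'"] allI ext mult_nonneg_nonneg
        gateaux_entire_cdir_deriv[OF linear(1)] dir_deriv_real_point[OF linear(1)] C(1) C'(1))
next
  case (add p P q Q)
  from add.IH(1)[OF add.prems] obtain g1 C1 where 1: "gateaux_entire g1" "C1 \<ge> 0"
    "\<And>z. cmod (g1 z) \<le> C1 * kernel_growth R Rp k l z" "P (\<lambda>y. g (real_point y)) = (\<lambda>y. g1 (real_point y))"
    by blast
  from add.IH(2)[OF add.prems] obtain g2 C2 where 2: "gateaux_entire g2" "C2 \<ge> 0"
    "\<And>z. cmod (g2 z) \<le> C2 * kernel_growth R Rp k l z" "Q (\<lambda>y. g (real_point y)) = (\<lambda>y. g2 (real_point y))"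
    by blast
  have "gateaux_entire (\<lambda>z. g1 z + g2 z)"
    by (rule gateaux_entire_add[OF 1(1) 2(1)])
  moreover have "cmod (g1 z + g2 z) \<le> (C1 + C2) * kernel_growth R Rp k l z" for z
    using norm_triangle_mono[OF 1(3) 2(3), of z z] by (simp add: distrib_right)
  ultimately show ?case
    using 1(2,4) 2(2,4) by (intro exI[of _ "\<lambda>z. g1 z + g2 z"] conjI exI[of _ "C1 + C2"] allI) simp_all
next
  \<comment> \<open>The inner operator \<open>Q\<close> yields an admissible function
    \<open>g2\<close>, to which the hypothesis for \<open>P\<close> applies; this is why
    \<open>g\<close> is generalized.\<close>
  case (mult p P q Q)
  from mult.IH(2)[OF mult.prems] obtain g2 where 2: "gateaux_entire g2"
    "\<exists>C\<ge>0. \<forall>z. cmod (g2 z) \<le> C * kernel_growth R Rp k l z" "Q (\<lambda>y. g (real_point y)) = (\<lambda>y. g2 (real_point y))"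
    by blast
  show ?case unfolding 2(3) by (rule mult.IH(1)[OF 2(1,2)])
qed

lemma kernel_growth_real_point:
  "kernel_growth R Rp k l (real_point x)
    = exp (orbit_exponent R l (real_point x)) * cmod (Omega_inv_sqrt Rp k x)"
proof -
  have "cmod (of_real (1 + \<bar>\<alpha> \<bullet> x\<bar>) powr (- k \<alpha>)) = exp (- (Re (k \<alpha>) * ln (1 + cmod (cinner (real_point \<alpha>) (real_point x)))))" for \<alpha>
  proof -
    have "cmod (cinner (real_point \<alpha>) (real_point x)) = \<bar>\<alpha> \<bullet> x\<bar>"
      by (simp add: cinner_def real_point_def cmod_def)
    moreover have "1 + \<bar>\<alpha> \<bullet> x\<bar> > 0" by (simp add: add_pos_nonneg)
    ultimately show ?thesis by (subst norm_powr_real_powr) (auto simp: powr_def)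
  qed
  then have "cmod (Omega_inv_sqrt Rp k x)
      = exp (- (\<Sum>\<alpha>\<in>Rp. Re (k \<alpha>) * ln (1 + cmod (cinner (real_point \<alpha>) (real_point x)))))"
    using finite_subset[OF positive_roots_subset finite_roots[OF R]]
    by (simp add: Omega_inv_sqrt_def prod_norm[symmetric] exp_sum sum_negf[symmetric])
  then show ?thesis by (simp add: kernel_growth_def flip: exp_add)
qed

end

theorem theorem2p5:
  fixes R Rp :: "'a::euclidean_space set"
    and k :: "'a \<Rightarrow> complex"
    and Exp_k :: "'a complexified \<Rightarrow> 'a complexified \<Rightarrow> complex"
    and l1 l2 :: 'a
    and p :: "'a \<Rightarrow> complex"
    and p_diff :: "('a \<Rightarrow> complex) \<Rightarrow> 'a \<Rightarrow> complex"
  assumes "root_system R"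
    and "positive_roots R Rp"
    and "invariant_multiplicity R k"
    and "\<And>\<alpha>. \<alpha> \<in> R \<Longrightarrow> Re (k \<alpha>) \<ge> 0"
    and "is_dunkl_kernel Rp k Exp_k"
    and "l2 \<in> regular_set R"
    and "polynomial_function p"
    and "diff_op_of p p_diff"
  shows "\<exists>C\<ge>0. \<forall>x::'a.
    cmod (p_diff (\<lambda>y. Exp_k (l1, l2) (real_point y)) x)
      \<le> C * exp (Max ((\<lambda>w. Re (cinner (complexify_map w (l1, l2)) (real_point x))) ` reflection_group R))
          * cmod (Omega_inv_sqrt Rp k x)"
proof -
  let ?c = "\<lambda>\<alpha>. cinner (real_point \<alpha>) (l1, l2)"
  have k: "\<forall>\<alpha>\<in>R. Re (k \<alpha>) \<ge> 0" using assms(4) by blast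
  note system = assms(1-3) k
  have "entire2 Exp_k" using assms(5) by (simp add: is_dunkl_kernel_def)
  then have ge: "gateaux_entire (Exp_k (l1, l2))" by (rule entire2_imp_gateaux_entire)
  \<comment> \<open>The imaginary part is \<open>\<alpha> \<bullet> l2\<close>, which is nonzero by
    regularity.\<close>
  have "?c \<alpha> \<noteq> 0" if "\<alpha> \<in> Rp" for \<alpha>
    using assms(6) that positive_roots_subset[OF system]
    by (auto simp: regular_set_def cinner_def real_point_def complex_eq_iff)
  then have "cmod (Exp_k (l1, l2) z) \<le> reflection_ode_const (reflection_group R) Rp k ?c
      * kernel_growth R Rp k (l1, l2) z" for z
    by (intro dunkl_kernel_bound[OF system assms(5)])
  moreover have "reflection_ode_const (reflection_group R) Rp k ?c \<ge> 0"
    by (simp add: reflection_ode_const_def Let_def)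
  ultimately have "\<exists>C\<ge>0. \<forall>z. cmod (Exp_k (l1, l2) z) \<le> C * kernel_growth R Rp k (l1, l2) z" by blast
  from diff_op_bound[OF system assms(8) ge this]
  obtain g C where C: "C \<ge> 0" "\<And>z. cmod (g z) \<le> C * kernel_growth R Rp k (l1, l2) z"
    and g: "p_diff (\<lambda>y. Exp_k (l1, l2) (real_point y)) = (\<lambda>y. g (real_point y))" by blast
  show ?thesis
  proof (intro exI[of _ C] conjI allI C(1))
    fix x
    show "cmod (p_diff (\<lambda>y. Exp_k (l1, l2) (real_point y)) x)
      \<le> C * exp (Max ((\<lambda>w. Re (cinner (complexify_map w (l1, l2)) (real_point x))) ` reflection_group R))
        * cmod (Omega_inv_sqrt Rp k x)"
      using C(2)[of "real_point x"]
      unfolding g kernel_growth_real_point[OF system] orbit_exponent_def by (simp only: mult.assoc)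
  qed
qed

end
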